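(* Let $\alpha\in(1,2)$, let $p\ge2$ and $n\ge1$ be integers. Then $T_n^{p,\alpha}=T_{n+p-2}(f^{p,\alpha})$, i.e. for every integer $k$ the number $t_k=\frac{1}{2\cos(\pi\alpha/2)}\left(D^{\alpha}_{-\infty,x}\phi_p\!\left(\tfrac{p+1}{2}-k\right)+D^{\alpha}_{x,+\infty}\phi_p\!\left(\tfrac{p+1}{2}-k\right)\right)$ equals the $k$-th Fourier coefficient $\frac{1}{2\pi}\int_{-\pi}^{\pi}f^{p,\alpha}(\theta)e^{-\mathrm{i}k\theta}\,d\theta$ of $$f^{p,\alpha}(\theta)=\sum_{l\in\mathbb Z}|\theta+2l\pi|^{\alpha}\left(\frac{\sin(\theta/2+l\pi)}{\theta/2+l\pi}\right)^{p+1}.$$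
   Context: The cardinal B-spline $\phi_p$ is defined by $\phi_0=\mathbf 1_{[0,1)}$ and $\phi_p(t)=\frac{t}{p}\phi_{p-1}(t)+\frac{p+1-t}{p}\phi_{p-1}(t-1)$ for $p\ge1$; it is supported on $[0,p+1]$. For compactly supported $u$ with absolutely continuous $(m-1)$-th derivative, $m-1\le\alpha<m$ integer, $D^{\alpha}_{-\infty,x}u(x)=\frac{1}{\Gamma(m-\alpha)}\frac{d^m}{dx^m}\int_{-\infty}^x (x-y)^{m-\alpha-1}u(y)\,dy$ and $D^{\alpha}_{x,+\infty}u(x)=\frac{(-1)^m}{\Gamma(m-\alpha)}\frac{d^m}{dx^m}\int_x^{+\infty}(y-x)^{m-\alpha-1}u(y)\,dy$. For $f\in L^1([-\pi,\pi])$ with Fourier coefficients $f_k=\frac1{2\pi}\int_{-\pi}^{\pi}f(\theta)e^{-\mathrm{i}k\theta}d\theta$, $T_N(f)$ is the $N\times N$ Toeplitz matrix with $(i,j)$ entry $f_{i-j}$. $T_n^{p,\alpha}$ is the $(n+p-2)\times(n+p-2)$ matrix with $(i,j)$ entry $t_{i-j}$, with $t_k$ as in the claim (equivalently, $T_n^{p,\alpha}=\frac{1}{2\cos(\pi\alpha/2)}(T^L+T^R)$ where $T^L_{ij}=D^{\alpha}_{-\infty,x}\phi_p(\frac{p+1}{2}+i-j)$ and $T^R_{ij}=D^{\alpha}_{x,+\infty}\phi_p(\frac{p+1}{2}+i-j)$). *)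

theory Defs
  imports "HOL-Analysis.Analysis"
begin

fun bspline :: "nat \<Rightarrow> real \<Rightarrow> real" where
  "bspline 0 t = indicator {0..<1} t"
| "bspline (Suc q) t =
     t / real (Suc q) * bspline q t + (real (Suc q) + 1 - t) / real (Suc q) * bspline q (t - 1)"

text \<open>Left Riemann-Liouville fractional derivative of order alpha, with m = ceiling alpha
  (so m - 1 \<le> alpha < m), for compactly supported u.\<close>
definition RL_left :: "real \<Rightarrow> (real \<Rightarrow> real) \<Rightarrow> real \<Rightarrow> real" where
  "RL_left \<alpha> u x =
     (let m = nat (\<lfloor>\<alpha>\<rfloor> + 1) in
      1 / Gamma (real m - \<alpha>) *
      ((deriv ^^ m) (\<lambda>z. integral {..z} (\<lambda>y. (z - y) powr (real m - \<alpha> - 1) * u y)) x))"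

definition RL_right :: "real \<Rightarrow> (real \<Rightarrow> real) \<Rightarrow> real \<Rightarrow> real" where
  "RL_right \<alpha> u x =
     (let m = nat (\<lfloor>\<alpha>\<rfloor> + 1) in
      (-1) ^ m / Gamma (real m - \<alpha>) *
      ((deriv ^^ m) (\<lambda>z. integral {z..} (\<lambda>y. (y - z) powr (real m - \<alpha> - 1) * u y)) x))"

definition tcoef :: "nat \<Rightarrow> real \<Rightarrow> int \<Rightarrow> real" where
  "tcoef p \<alpha> k =
     1 / (2 * cos (pi * \<alpha> / 2)) *
     (RL_left \<alpha> (bspline p) ((real p + 1) / 2 - real_of_int k)
      + RL_right \<alpha> (bspline p) ((real p + 1) / 2 - real_of_int k))"

definition symbol_f :: "nat \<Rightarrow> real \<Rightarrow> real \<Rightarrow> real" where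
  "symbol_f p \<alpha> \<theta> =
     (\<Sum>\<^sub>\<infinity> l::int. \<bar>\<theta> + 2 * real_of_int l * pi\<bar> powr \<alpha> *
        (sin (\<theta> / 2 + real_of_int l * pi) / (\<theta> / 2 + real_of_int l * pi)) ^ (p + 1))"

definition fourier_coeff :: "(real \<Rightarrow> real) \<Rightarrow> int \<Rightarrow> complex" where
  "fourier_coeff f k =
     1 / (2 * pi) * integral {-pi..pi} (\<lambda>\<theta>. complex_of_real (f \<theta>) * exp (- \<i> * of_int k * of_real \<theta>))"

definition toeplitz :: "nat \<Rightarrow> (real \<Rightarrow> real) \<Rightarrow> nat \<Rightarrow> nat \<Rightarrow> complex" where
  "toeplitz N f i j = (if i < N \<and> j < N then fourier_coeff f (int i - int j) else 0)"

definition Tmat :: "nat \<Rightarrow> nat \<Rightarrow> real \<Rightarrow> nat \<Rightarrow> nat \<Rightarrow> complex" where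
  "Tmat n p \<alpha> i j = (if i < n + p - 2 \<and> j < n + p - 2
                        then complex_of_real (tcoef p \<alpha> (int i - int j)) else 0)"

end

theory Submission
  imports Defs
begin

text \<open>Put \<open>b = p - \<alpha>\<close>, \<open>x = (p + 1) / 2 - k\<close>, \<open>a\<^sub>j = x - j\<close> and
  \<open>c\<^sub>j = (-1)^j (p + 1 choose j)\<close>.  Since the B-spline is \<open>(\<Sum>j. c\<^sub>j max 0 (t - j)^p) / p!\<close>, Beta
  integrals and two differentiations give the left derivative at \<open>x\<close> as
  \<open>(\<Sum>j. c\<^sub>j max 0 a\<^sub>j powr b) / Gamma (b + 1)\<close>; the right one is its reflection.

  Periodization turns the Fourier coefficient of the symbol into an integral over the real line,
  which is twice the real part of the integral over the positive half-line. There, expanding the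
  power of the sine, the integrand is a constant times
  \<open>\<xi> powr (-b - 1) * (\<Sum>j. c\<^sub>j exp (\<i> a\<^sub>j \<xi>))\<close>. The power moments of the \<open>c\<^sub>j\<close> up to order \<open>p\<close>
  vanish, so the integral is \<open>Gamma (-b) * (\<Sum>j. c\<^sub>j (-\<i> a\<^sub>j) powr b)\<close>, the same formula as for
  negative \<open>b\<close>. The two sides then agree by the reflection formula for the Gamma function.\<close>

subsection \<open>The Gamma integral with a complex scale\<close>

lemma absolutely_integrable_continuous_dominated:
  fixes f :: "real \<Rightarrow> complex"
  assumes "continuous_on {0<..} f" "g integrable_on {0<..}"
    and "\<And>x. x > 0 \<Longrightarrow> norm (f x) \<le> g x"
  shows "f absolutely_integrable_on {0<..}"
  using assms
  by (intro measurable_bounded_by_integrable_imp_absolutely_integrable[where g = g]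
        continuous_imp_measurable_on_sets_lebesgue) auto

text \<open>The fundamental theorem of calculus applies on the compact intervals \<open>I k\<close>,
  which exhaust the half-line; \<open>norm (f x)\<close> dominates the truncations, so the limit may
  be taken. The integrations by parts below all go through this form, with \<open>F\<close> as
  boundary term.\<close>

lemma has_integral_Ioi_derivative:
  fixes F f :: "real \<Rightarrow> complex"
  assumes deriv: "\<And>x. x > 0 \<Longrightarrow> (F has_vector_derivative f x) (at x)"
    and int: "f absolutely_integrable_on {0<..}"
    and lim0: "(F \<longlongrightarrow> 0) (at_right 0)" and limI: "(F \<longlongrightarrow> 0) at_top"
  shows "(f has_integral 0) {0<..}"
proof -
  define I where "I = (\<lambda>k::nat. {inverse (real (Suc k))..real (Suc k)})"
  have le: "inverse (real (Suc k)) \<le> real (Suc k)" for k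
    by (simp add: field_simps)
  have I: "I k \<subseteq> {0<..}" for k
    unfolding I_def by (force intro: less_le_trans[of 0 "inverse (real (Suc k))"])
  have part: "((\<lambda>x. if x \<in> I k then f x else 0) has_integral F (real (Suc k)) - F (inverse (real (Suc k)))) {0<..}" for k
  proof (subst has_integral_restrict[OF I])
    show "(f has_integral F (real (Suc k)) - F (inverse (real (Suc k)))) (I k)"
      unfolding I_def using I[of k] unfolding I_def
      by (intro fundamental_theorem_of_calculus le)
        (auto intro!: has_vector_derivative_at_within deriv)
  qed
  show ?thesis
  proof (rule has_integral_dominated_convergence[OF part, where h = "\<lambda>x. norm (f x)"])
    show "(\<lambda>x. norm (f x)) integrable_on {0<..}"
      using int by (simp add: absolutely_integrable_on_def)
    show "\<forall>x\<in>{0<..}. norm (if x \<in> I k then f x else 0) \<le> norm (f x)" for k by simp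
    show "\<forall>x\<in>{0<..}. (\<lambda>k. if x \<in> I k then f x else 0) \<longlonglongrightarrow> f x"
    proof
      fix x :: real assume x: "x \<in> {0<..}"
      have "(\<lambda>k. inverse (real (Suc k))) \<longlonglongrightarrow> 0"
        by (rule LIMSEQ_inverse_real_of_nat)
      then have "eventually (\<lambda>k. inverse (real (Suc k)) < x) sequentially"
        using x by (auto dest: order_tendstoD)
      moreover have "eventually (\<lambda>k. x < real (Suc k)) sequentially"
        by (rule eventually_compose_filterlim[OF eventually_gt_at_top])
          (intro filterlim_compose[OF filterlim_real_sequentially filterlim_Suc])
      ultimately have "eventually (\<lambda>k. (if x \<in> I k then f x else 0) = f x) sequentially"
        by eventually_elim (auto simp: I_def)
      then show "(\<lambda>k. if x \<in> I k then f x else 0) \<longlonglongrightarrow> f x"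
        by (rule tendsto_eventually)
    qed
    have "(\<lambda>k. F (real (Suc k))) \<longlonglongrightarrow> 0"
      by (rule filterlim_compose[OF limI filterlim_compose[OF filterlim_real_sequentially filterlim_Suc]])
    moreover have "(\<lambda>k. F (inverse (real (Suc k)))) \<longlonglongrightarrow> 0"
      by (rule filterlim_compose[OF lim0])
        (rule tendsto_imp_filterlim_at_right[OF LIMSEQ_inverse_real_of_nat], simp)
    ultimately show "(\<lambda>k. F (real (Suc k)) - F (inverse (real (Suc k)))) \<longlonglongrightarrow> 0"
      using tendsto_diff by fastforce
  qed
qed

lemma integrable_powr_exp:
  fixes s a :: real
  assumes "s > 0" "a > 0"
  shows "(\<lambda>t. t powr (s - 1) * exp (- (a * t))) integrable_on {0<..}"
proof -
  have "(\<lambda>t. norm (complex_of_real t powr (complex_of_real s - 1) / of_real (exp (a * t)))) integrable_on {0<..}"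
    using absolutely_integrable_Gamma_integral[of "of_real s" a] assms
    unfolding absolutely_integrable_on_def by simp
  then show ?thesis
    by (rule integrable_eq) (simp add: norm_divide norm_powr_real_powr exp_minus field_simps)
qed

lemma powr_exp_dominated:
  fixes h :: "real \<Rightarrow> complex" and s a C :: real
  assumes "s > 0" "a > 0" and cont: "continuous_on {0<..} h"
    and le: "\<And>t. t > 0 \<Longrightarrow> norm (h t) \<le> C * (t powr (s - 1) * exp (- (a * t)))"
  shows "h absolutely_integrable_on {0<..}"
    using integrable_on_cmult_left[OF integrable_powr_exp[OF assms(1,2)], of C] le
    by (intro absolutely_integrable_continuous_dominated[OF cont, where g = "\<lambda>t. C * (t powr (s - 1) * exp (- (a * t)))"])
       auto

definition laplace_powr :: "real \<Rightarrow> complex \<Rightarrow> real \<Rightarrow> complex" where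
  "laplace_powr s z t = of_real (t powr (s - 1)) * exp (- (z * of_real t))"

lemma continuous_on_laplace_powr: "continuous_on {0<..} (laplace_powr s z)"
  unfolding laplace_powr_def by (intro continuous_intros) auto

lemma norm_laplace_powr: "norm (laplace_powr s z t) = t powr (s - 1) * exp (- (Re z * t))"
  by (simp add: laplace_powr_def norm_mult)

lemma absolutely_integrable_laplace_powr:
  assumes "s > 0" "Re z > 0"
  shows "laplace_powr s z absolutely_integrable_on {0<..}"
  using assms by (intro powr_exp_dominated[where s = s and a = "Re z" and C = 1] continuous_on_laplace_powr)
    (simp_all add: norm_laplace_powr)

lemma integrable_laplace_powr:
  assumes "s > 0" "Re z > 0"
  shows "laplace_powr s z integrable_on {0<..}"
  using absolutely_integrable_laplace_powr[OF assms] by (rule set_lebesgue_integral_eq_integral)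

lemma powr_exp_tendsto_0_at_top:
  fixes s a :: real assumes "a > 0"
  shows "((\<lambda>t. t powr s * exp (- (a * t))) \<longlongrightarrow> 0) at_top"
proof -
  define k where "k = nat \<lceil>s\<rceil>"
  have "((\<lambda>t. ((a * t) ^ k / exp (a * t)) / a ^ k) \<longlongrightarrow> 0 / a ^ k) at_top"
    using assms
    by (intro tendsto_divide tendsto_const filterlim_compose[OF tendsto_power_div_exp_0]
          filterlim_tendsto_pos_mult_at_top[OF tendsto_const] filterlim_ident) auto
  then have lim: "((\<lambda>t. t ^ k * exp (- (a * t))) \<longlongrightarrow> 0) at_top"
    using assms by (simp add: power_mult_distrib exp_minus field_simps)
  show ?thesis
  proof (rule Lim_null_comparison[OF _ lim])
    show "\<forall>\<^sub>F t in at_top. norm (t powr s * exp (- (a * t))) \<le> t ^ k * exp (- (a * t))"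
      using eventually_ge_at_top[of 1]
    proof eventually_elim
      fix t :: real assume t: "1 \<le> t"
      have "t powr s \<le> t powr (real k)"
        using t by (intro powr_mono) (auto simp: k_def real_nat_ceiling_ge)
      then show "norm (t powr s * exp (- (a * t))) \<le> t ^ k * exp (- (a * t))"
        using t by (simp add: powr_realpow mult_right_mono)
    qed
  qed
qed

lemma has_vector_derivative_exp_of_real:
  fixes z :: complex
  shows
  "((\<lambda>t. exp (- (z * of_real t))) has_vector_derivative - z * exp (- (z * of_real x))) (at x)"
  by (rule has_vector_derivative_real_field) (auto intro!: derivative_eq_intros)

lemma has_vector_derivative_of_real_powr:
  assumes "x > 0"
  shows "((\<lambda>t. complex_of_real (t powr s)) has_vector_derivative of_real (s * x powr (s - 1))) (at x)"
  by (intro has_vector_derivative_of_real)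
    (use assms has_real_derivative_powr[OF assms, of s] in \<open>simp add: has_real_derivative_iff_has_vector_derivative\<close>)

text \<open>Integration by parts with boundary term \<open>t powr s * exp (- (z * t))\<close>: the
  functional equation of Gamma at scale \<open>z\<close>. It is what makes the derivative vanish in
  \<open>has_integral_laplace_powr\<close>.\<close>

lemma laplace_powr_shift:
  assumes s: "s > 0" and z: "Re z > 0"
  shows "z * integral {0<..} (laplace_powr (s + 1) z) = s * integral {0<..} (laplace_powr s z)"
proof -
  let ?F = "\<lambda>t. of_real (t powr s) * exp (- (z * of_real t))"
  let ?f = "\<lambda>t. of_real s * laplace_powr s z t - z * laplace_powr (s + 1) z t"
  have "(?f has_integral 0) {0<..}"
  proof (rule has_integral_Ioi_derivative)
    show "(?F has_vector_derivative ?f x) (at x)" if "x > 0" for x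
      by (rule has_vector_derivative_eq_rhs[OF has_vector_derivative_mult[OF
            has_vector_derivative_of_real_powr[OF that] has_vector_derivative_exp_of_real]])
        (simp add: laplace_powr_def algebra_simps)
    show "?f absolutely_integrable_on {0<..}"
      using s z by (intro set_integral_diff set_integrable_mult_right absolutely_integrable_laplace_powr) auto
    have "((\<lambda>t. t powr s * exp (- (Re z * t))) \<longlongrightarrow> 0 powr s * exp (- (Re z * 0))) (at_right 0)"
      using s by (intro tendsto_intros) (auto intro!: eventually_at_rightI[of 0 1])
    then show "(?F \<longlongrightarrow> 0) (at_right 0)"
      using s by (subst tendsto_norm_zero_iff[symmetric]) (simp add: norm_mult)
    show "(?F \<longlongrightarrow> 0) at_top"
      using powr_exp_tendsto_0_at_top[OF z]
      by (subst tendsto_norm_zero_iff[symmetric]) (simp add: norm_mult)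
  qed
  moreover have "(?f has_integral (s * integral {0<..} (laplace_powr s z) - z * integral {0<..} (laplace_powr (s + 1) z))) {0<..}"
    using s z by (intro has_integral_diff has_integral_mult_right integrable_integral integrable_laplace_powr) auto
  ultimately have "s * integral {0<..} (laplace_powr s z) - z * integral {0<..} (laplace_powr (s + 1) z) = 0"
    by (rule has_integral_unique[THEN sym])
  then show ?thesis by simp
qed

lemma norm_exp_minus_linear_le:
  "norm (exp (- (h * of_real t)) - 1 + h * of_real t) \<le> (cmod h * t)^2 * exp (\<bar>t\<bar> * cmod h)"
proof -
  have "exp (- (h * of_real t)) - 1 + h * of_real t
      = exp (- (h * of_real t)) - (\<Sum>i\<le>1. (- (h * of_real t)) ^ i / fact i)"
    by simp
  also have "norm \<dots> \<le> exp (cmod h * \<bar>t\<bar>) * (cmod h * \<bar>t\<bar>) ^ 2"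
    using Taylor_exp_field[of "- (h * of_real t)" 1] by (simp add: norm_mult numeral_2_eq_2)
  finally show ?thesis by (simp add: power_mult_distrib mult.commute)
qed

text \<open>Differentiation under the integral sign: the second-order Taylor remainder of the
  exponential bounds the error of the linear approximation by \<open>(cmod h)^2\<close> times a
  convergent integral that does not depend on \<open>h\<close>.\<close>

lemma DERIV_laplace_powr_integral:
  assumes s: "s > 0" and z: "Re z > 0"
  shows "((\<lambda>z. integral {0<..} (laplace_powr s z)) has_field_derivative
    - integral {0<..} (laplace_powr (s + 1) z)) (at z)"
proof -
  let ?L = "\<lambda>s z. integral {0<..} (laplace_powr s z)"
  \<comment> \<open>A perturbation of size at most half of \<open>Re z\<close> leaves the decay
    \<open>exp (- (r * t))\<close>, so one constant \<open>C\<close> serves for all such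
    \<open>h\<close>; its two extra powers of \<open>t\<close> come from the Taylor
    remainder.\<close>
  define r where "r = Re z / 2"
  define C where "C = integral {0<..} (\<lambda>t. t powr ((s + 2) - 1) * exp (- (r * t)))"
  have r: "r > 0" "Re z = 2 * r" using z by (auto simp: r_def)
  have bound: "norm (?L s (z + h) - ?L s z + h * ?L (s + 1) z) \<le> (cmod h)^2 * C" if h: "norm h \<le> r" for h
  proof -
    have rh: "Re (z + h) > 0"
      using abs_Re_le_cmod[of h] h r by simp
    have 1: "((\<lambda>t. laplace_powr s (z + h) t - laplace_powr s z t + h * laplace_powr (s + 1) z t) has_integral
        (?L s (z + h) - ?L s z + h * ?L (s + 1) z)) {0<..}"
      using s z rh by (intro has_integral_diff has_integral_add has_integral_mult_right integrable_integral integrable_laplace_powr) auto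
    have 2: "((\<lambda>t. (cmod h)^2 * (t powr ((s + 2) - 1) * exp (- (r * t)))) has_integral (cmod h)^2 * C) {0<..}"
      unfolding C_def using s r
      by (intro has_integral_mult_right integrable_integral integrable_powr_exp) auto
    have le: "norm (laplace_powr s (z + h) t - laplace_powr s z t + h * laplace_powr (s + 1) z t)
       \<le> (cmod h)^2 * (t powr ((s + 2) - 1) * exp (- (r * t)))" if t: "t \<in> {0<..}" for t
    proof -
      have "laplace_powr s (z + h) t - laplace_powr s z t + h * laplace_powr (s + 1) z t
        = laplace_powr s z t * (exp (- (h * of_real t)) - 1 + h * of_real t)"
        using t powr_add[of t "s - 1" 1] exp_add[of "- (z * of_real t)" "- (h * of_real t)"]
        by (simp add: laplace_powr_def ring_distribs)
      also have "norm \<dots> \<le> (t powr (s - 1) * exp (- (Re z * t))) * ((cmod h * t)^2 * exp (\<bar>t\<bar> * norm h))"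
        unfolding norm_mult norm_laplace_powr
        by (intro mult_left_mono norm_exp_minus_linear_le) auto
      also have "\<dots> = (cmod h)^2 * (t powr (s + 1) * exp (t * cmod h - Re z * t))"
        using t by (simp add: powr_diff powr_add exp_diff exp_minus power2_eq_square field_simps)
      also have "\<dots> \<le> (cmod h)^2 * (t powr (s + 1) * exp (- (r * t)))"
      proof -
        have "t * cmod h \<le> t * r" using t h by (intro mult_left_mono) auto
        then show ?thesis
          by (intro mult_left_mono) (auto simp: r algebra_simps)
      qed
      finally show ?thesis by (simp add: algebra_simps)
    qed
    show ?thesis
      using integral_norm_bound_integral[OF has_integral_integrable[OF 1] has_integral_integrable[OF 2] le]
      unfolding integral_unique[OF 1] integral_unique[OF 2] .
  qed
  show ?thesis
    unfolding DERIV_def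
  proof (rule LIM_zero_cancel, rule Lim_null_comparison)
    have "eventually (\<lambda>h::complex. norm h < r \<and> h \<noteq> 0) (at 0)"
      unfolding eventually_at using r by (intro exI[of _ r]) auto
    then show "\<forall>\<^sub>F h in at 0. norm ((?L s (z + h) - ?L s z) / h - (- ?L (s + 1) z)) \<le> norm h * C"
    proof eventually_elim
      fix h :: complex assume h: "norm h < r \<and> h \<noteq> 0"
      have "(?L s (z + h) - ?L s z) / h - (- ?L (s + 1) z) = (?L s (z + h) - ?L s z + h * ?L (s + 1) z) / h"
        using h by (simp add: field_simps)
      also have "norm \<dots> \<le> ((cmod h)^2 * C) / norm h"
        unfolding norm_divide using bound[of h] h by (intro divide_right_mono) auto
      also have "\<dots> = norm h * C" using h by (simp add: power2_eq_square)
      finally show "norm ((?L s (z + h) - ?L s z) / h - (- ?L (s + 1) z)) \<le> norm h * C" .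
    qed
    show "((\<lambda>h. norm h * C) \<longlongrightarrow> 0) (at (0::complex))"
      by (auto intro!: tendsto_eq_intros)
  qed
qed

text \<open>The function \<open>z powr s * integral {0<..} (laplace_powr s z)\<close> has derivative 0 on the right
  half-plane, so its value is the one at \<open>z = 1\<close>.\<close>

lemma has_integral_laplace_powr:
  assumes s: "s > 0" and z: "Re z > 0"
  shows "(laplace_powr s z has_integral of_real (Gamma s) * z powr (- of_real s)) {0<..}"
proof -
  let ?L = "\<lambda>z. integral {0<..} (laplace_powr s z)"
  let ?G = "\<lambda>z. z powr of_real s * ?L z"
  have S: "z \<noteq> 0" "z \<notin> \<real>\<^sub>\<le>\<^sub>0" if "Re z > 0" for z
    using that by (auto simp: complex_nonpos_Reals_iff)
  have "\<exists>c. \<forall>z\<in>{z. 0 < Re z}. ?G z = c"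
  proof (rule has_field_derivative_zero_constant)
    show "convex {z. 0 < Re z}" by (rule convex_halfspace_Re_gt)
    fix z assume "z \<in> {z. 0 < Re z}"
    then have z: "Re z > 0" by simp
    have "(?G has_field_derivative (of_real s * z powr (of_real s - 1)) * ?L z
            + (- integral {0<..} (laplace_powr (s + 1) z)) * z powr of_real s) (at z)"
      using s z S
      by (intro DERIV_mult DERIV_laplace_powr_integral has_field_derivative_powr) auto
    also have "(of_real s * z powr (of_real s - 1)) * ?L z
            + (- integral {0<..} (laplace_powr (s + 1) z)) * z powr of_real s =
          z powr (of_real s - 1) * (s * ?L z - z * integral {0<..} (laplace_powr (s + 1) z))"
      using S[OF z] by (simp add: powr_diff field_simps)
    also have "\<dots> = 0" using laplace_powr_shift[OF s z] by simp
    finally show "(?G has_field_derivative 0) (at z within {z. 0 < Re z})"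
      by (rule has_field_derivative_at_within)
  qed
  then obtain c where "\<And>z. Re z > 0 \<Longrightarrow> ?G z = c" by auto
  from this[OF z] this[of 1] have "?G z = ?L 1" by simp
  also have "?L 1 = of_real (Gamma s)"
  proof (rule integral_unique)
    have "((\<lambda>t. complex_of_real t powr (of_real s - 1) / of_real (exp t)) has_integral Gamma (of_real s)) {0<..}"
      using s by (intro Gamma_integral_complex') auto
    moreover have "complex_of_real t powr (of_real s - 1) / of_real (exp t) = laplace_powr s 1 t" if "t \<in> {0<..}" for t
      using that powr_of_real[of t "s - 1"] by (simp add: laplace_powr_def exp_minus divide_inverse exp_of_real)
    ultimately show "(laplace_powr s 1 has_integral of_real (Gamma s)) {0<..}"
      using has_integral_eq by (metis (lifting) Gamma_complex_of_real)
  qed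
  finally have "?L z = of_real (Gamma s) * z powr (- of_real s)"
    using S[OF z] by (simp add: powr_minus field_simps)
  then show ?thesis
    using integrable_laplace_powr[OF s z] by (metis integrable_integral)
qed

subsection \<open>Exponential sums with vanishing moments\<close>

text \<open>Up to sign this is an \<open>n\<close>-th finite difference, which annihilates
  polynomials of degree below \<open>n\<close>. Pascal's rule turns order \<open>Suc n\<close> into
  order \<open>n\<close> applied to first differences, and a first difference lowers the
  degree.\<close>

lemma sum_binomial_power_eq_0:
  "k < n \<Longrightarrow> (\<Sum>j\<le>n. (-1) ^ j * of_nat (n choose j) * (u + v * of_nat j) ^ k) = (0 :: complex)"
proof (induction n arbitrary: k u v)
  case (Suc n)
  have shift: "(\<Sum>j\<le>Suc n. (-1) ^ j * of_nat (Suc n choose j) * f j) =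
     (\<Sum>j\<le>n. (-1) ^ j * of_nat (n choose j) * (f j - f (Suc j)))" for f :: "nat \<Rightarrow> complex"
  proof -
    have 1: "(\<Sum>j\<le>Suc n. (-1) ^ j * of_nat (n choose j) * f j) = (\<Sum>j\<le>n. (-1) ^ j * of_nat (n choose j) * f j)"
      by simp
    have "(\<Sum>j\<le>Suc n. (-1) ^ j * of_nat (Suc n choose j) * f j) =
       f 0 + (\<Sum>j\<le>n. (-1) ^ Suc j * of_nat (Suc n choose Suc j) * f (Suc j))"
      by (subst sum.atMost_Suc_shift) simp
    also have "\<dots> = (f 0 + (\<Sum>j\<le>n. (-1) ^ Suc j * of_nat (n choose Suc j) * f (Suc j)))
                 - (\<Sum>j\<le>n. (-1) ^ j * of_nat (n choose j) * f (Suc j))"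
      by (simp add: algebra_simps sum.distrib sum_negf sum_subtractf)
    also have "f 0 + (\<Sum>j\<le>n. (-1) ^ Suc j * of_nat (n choose Suc j) * f (Suc j))
        = (\<Sum>j\<le>Suc n. (-1) ^ j * of_nat (n choose j) * f j)"
      by (subst sum.atMost_Suc_shift) simp
    finally show ?thesis unfolding 1 by (simp add: algebra_simps sum_subtractf)
  qed
  have "(u + v * of_nat j) ^ k - (u + v * of_nat (Suc j)) ^ k
      = - (\<Sum>i<k. of_nat (k choose i) * v ^ (k - i) * (u + v * of_nat j) ^ i)" for j
  proof -
    have "(u + v * of_nat (Suc j)) ^ k = ((u + v * of_nat j) + v) ^ k"
      by (simp add: algebra_simps)
    also have "\<dots> = (\<Sum>i\<le>k. of_nat (k choose i) * (u + v * of_nat j) ^ i * v ^ (k - i))"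
      by (rule binomial_ring)
    also have "{..k} = insert k {..<k}" by auto
    finally show ?thesis by (simp add: mult_ac)
  qed
  then have "(\<Sum>j\<le>Suc n. (-1) ^ j * of_nat (Suc n choose j) * (u + v * of_nat j) ^ k)
      = (\<Sum>j\<le>n. (-1) ^ j * of_nat (n choose j) * - (\<Sum>i<k. of_nat (k choose i) * v ^ (k - i) * (u + v * of_nat j) ^ i))"
    unfolding shift by simp
  also have "\<dots> = - (\<Sum>i<k. of_nat (k choose i) * v ^ (k - i) * (\<Sum>j\<le>n. (-1) ^ j * of_nat (n choose j) * (u + v * of_nat j) ^ i))"
    by (simp add: sum_distrib_left sum_negf) (subst sum.swap, simp add: mult_ac)
  also have "\<dots> = 0"
    using Suc.prems by (simp add: Suc.IH)
  finally show ?case .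
qed simp

text \<open>The moment \<open>(\<Sum>j\<in>J. c j * z j ^ k)\<close>, assumed to vanish in the
  lemmas below, is up to the factor \<open>(-1) ^ k / fact k\<close> the \<open>k\<close>-th Taylor
  coefficient of this function at 0.\<close>

definition expsum :: "'a set \<Rightarrow> ('a \<Rightarrow> complex) \<Rightarrow> ('a \<Rightarrow> complex) \<Rightarrow> real \<Rightarrow> complex" where
  "expsum J c z t = (\<Sum>j\<in>J. c j * exp (- (z j * of_real t)))"

lemma continuous_on_expsum: "continuous_on S (expsum J c z)"
  unfolding expsum_def by (intro continuous_intros)

lemma has_vector_derivative_expsum:
  "(expsum J c z has_vector_derivative expsum J (\<lambda>j. - c j * z j) z x) (at x)"
  unfolding expsum_def
  by (intro has_vector_derivative_sum)
    (rule has_vector_derivative_eq_rhs[OF has_vector_derivative_mult_right[OF has_vector_derivative_exp_of_real]], simp)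

lemma norm_expsum_le_exp:
  assumes "\<And>j. j \<in> J \<Longrightarrow> a \<le> Re (z j)" "t \<ge> 0"
  shows "norm (expsum J c z t) \<le> (\<Sum>j\<in>J. norm (c j)) * exp (- (a * t))"
  unfolding expsum_def sum_distrib_right
  using assms by (intro sum_norm_le) (auto simp: norm_mult intro!: mult_left_mono mult_right_mono)

text \<open>Vanishing moments make the Taylor polynomials of degree \<open>m - 1\<close> of the
  summands cancel in the sum. They can therefore be subtracted for free, and only remainders of
  order \<open>t ^ m\<close> are left.\<close>

lemma norm_expsum_le_power:
  assumes "\<And>k. k < m \<Longrightarrow> (\<Sum>j\<in>J. c j * z j ^ k) = 0"
  shows "\<exists>C\<ge>0. \<forall>t\<in>{0..1}. norm (expsum J c z t) \<le> C * t ^ m"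
proof (cases m)
  \<comment> \<open>Here there is no polynomial to subtract, and a constant bound on the unit
    interval suffices.\<close>
  case 0
  define C where "C = (\<Sum>j\<in>J. norm (c j) * exp (norm (z j)))"
  have "norm (expsum J c z t) \<le> C" if "t \<in> {0..1}" for t
    unfolding expsum_def C_def
  proof (intro sum_norm_le)
    fix j
    have "norm (exp (- (z j * of_real t))) \<le> exp (norm (z j) * t)"
      using norm_exp[of "- (z j * of_real t)"] that by (simp add: norm_mult)
    also have "\<dots> \<le> exp (norm (z j))"
      using that by (simp add: mult_left_le)
    finally show "norm (c j * exp (- (z j * of_real t))) \<le> norm (c j) * exp (norm (z j))"
      by (simp add: norm_mult mult_left_mono)
  qed
  moreover have "C \<ge> 0" unfolding C_def by (intro sum_nonneg) auto
  ultimately show ?thesis using 0 by auto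
next
  case (Suc n)
  define C where "C = (\<Sum>j\<in>J. norm (c j) * (exp (norm (z j)) * norm (z j) ^ Suc n / fact n))"
  have "norm (expsum J c z t) \<le> C * t ^ m" if t: "t \<in> {0..1}" for t
  proof -
    have "(\<Sum>j\<in>J. c j * (\<Sum>k\<le>n. (- (z j * of_real t)) ^ k / fact k))
        = (\<Sum>k\<le>n. (- of_real t) ^ k / fact k * (\<Sum>j\<in>J. c j * z j ^ k))"
      unfolding sum_distrib_left
      by (subst sum.swap) (simp add: power_mult_distrib power_minus[of "_ * _"] power_minus[of "of_real t"] mult_ac)
    also have "\<dots> = 0" using assms Suc by simp
    finally have "expsum J c z t =
        (\<Sum>j\<in>J. c j * (exp (- (z j * of_real t)) - (\<Sum>k\<le>n. (- (z j * of_real t)) ^ k / fact k)))"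
      by (simp add: expsum_def algebra_simps sum_subtractf)
    also have "norm \<dots> \<le> (\<Sum>j\<in>J. norm (c j) * (exp (norm (z j)) * norm (z j) ^ Suc n / fact n) * t ^ m)"
    proof (intro sum_norm_le)
      fix j
      let ?w = "- (z j * of_real t)"
      have nw: "norm ?w = norm (z j) * t" using t by (simp add: norm_mult)
      have "norm (exp ?w - (\<Sum>k\<le>n. ?w ^ k / fact k)) \<le> exp (norm ?w) * (norm ?w ^ Suc n) / fact n"
        by (rule Taylor_exp_field)
      also have "\<dots> \<le> exp (norm (z j)) * (norm ?w ^ Suc n) / fact n"
        unfolding nw using t by (intro divide_right_mono mult_right_mono) (auto simp: mult_left_le)
      also have "\<dots> = exp (norm (z j)) * norm (z j) ^ Suc n / fact n * t ^ m"
        unfolding nw by (simp add: Suc power_mult_distrib)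
      finally show "norm (c j * (exp ?w - (\<Sum>k\<le>n. ?w ^ k / fact k)))
          \<le> norm (c j) * (exp (norm (z j)) * norm (z j) ^ Suc n / fact n) * t ^ m"
        by (simp only: norm_mult mult.assoc mult_left_mono norm_ge_zero)
    qed
    finally show ?thesis by (simp add: C_def sum_distrib_right)
  qed
  moreover have "C \<ge> 0" unfolding C_def by (intro sum_nonneg) auto
  ultimately show ?thesis by auto
qed

lemma norm_expsum_le:
  assumes "\<And>k. k < m \<Longrightarrow> (\<Sum>j\<in>J. c j * z j ^ k) = 0"
    and a: "\<And>j. j \<in> J \<Longrightarrow> a \<le> Re (z j)" "a \<ge> 0"
  shows "\<exists>C\<ge>0. \<forall>t>0. norm (expsum J c z t) \<le> C * (t ^ m * exp (- (a * t)))"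
proof -
  obtain D where D: "D \<ge> 0" "\<And>t. t \<in> {0..1} \<Longrightarrow> norm (expsum J c z t) \<le> D * t ^ m"
    using norm_expsum_le_power[OF assms(1)] by blast
  define E where "E = (\<Sum>j\<in>J. norm (c j))"
  have E: "E \<ge> 0" unfolding E_def by (intro sum_nonneg) auto
  \<comment> \<open>Near 0 the power bound is used and \<open>exp a\<close> offsets the factor
    \<open>exp (- (a * t))\<close>; beyond 1 the exponential bound is used and \<open>t ^ m\<close>
    is at least 1.\<close>
  have "norm (expsum J c z t) \<le> (D * exp a + E) * (t ^ m * exp (- (a * t)))" if t: "t > 0" for t
  proof (cases "t \<le> 1")
    case True
    have "norm (expsum J c z t) \<le> D * t ^ m * 1" using D(2)[of t] t True by auto
    also have "\<dots> \<le> D * t ^ m * (exp a * exp (- (a * t)))"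
      using D t True a by (intro mult_left_mono) (auto simp: mult_left_le simp flip: exp_add)
    also have "\<dots> = D * exp a * (t ^ m * exp (- (a * t)))" by simp
    also have "\<dots> \<le> (D * exp a + E) * (t ^ m * exp (- (a * t)))"
      using E t by (intro mult_right_mono) auto
    finally show ?thesis .
  next
    case False
    have "norm (expsum J c z t) \<le> E * exp (- (a * t))"
      unfolding E_def using a t by (intro norm_expsum_le_exp) auto
    also have "\<dots> \<le> E * (t ^ m * exp (- (a * t)))"
      using False E by (intro mult_left_mono) auto
    also have "\<dots> \<le> (D * exp a + E) * (t ^ m * exp (- (a * t)))"
      using D t by (intro mult_right_mono) auto
    finally show ?thesis .
  qed
  moreover have "D * exp a + E \<ge> 0" using D E by simp
  ultimately show ?thesis by blast
qed

text \<open>Each vanishing moment gains a power of \<open>t\<close> at 0, which allows exponents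
  \<open>s\<close> down to \<open>- real m\<close>; decay at infinity comes from
  \<open>a > 0\<close>.\<close>

lemma absolutely_integrable_powr_expsum:
  assumes "\<And>k. k < m \<Longrightarrow> (\<Sum>j\<in>J. c j * z j ^ k) = 0"
    and "\<And>j. j \<in> J \<Longrightarrow> a \<le> Re (z j)" "a > 0" "s > - real m"
  shows "(\<lambda>t. of_real (t powr (s - 1)) * expsum J c z t) absolutely_integrable_on {0<..}"
proof -
  obtain C where C: "\<And>t. t > 0 \<Longrightarrow> norm (expsum J c z t) \<le> C * (t ^ m * exp (- (a * t)))"
    using norm_expsum_le[OF assms(1,2)] assms(3) by (meson less_imp_le)
  show ?thesis
  proof (rule powr_exp_dominated)
    show "s + m > 0" "a > 0" using assms by auto
    show "continuous_on {0<..} (\<lambda>t. of_real (t powr (s - 1)) * expsum J c z t)"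
      by (intro continuous_intros continuous_on_expsum) auto
    show "norm (of_real (t powr (s - 1)) * expsum J c z t) \<le> C * (t powr (s + m - 1) * exp (- (a * t)))"
      if "t > 0" for t
    proof -
      have "t powr (s + m - 1) = t powr (s - 1) * t ^ m"
        using that by (simp add: powr_realpow[symmetric] flip: powr_add) (simp add: algebra_simps)
      then show ?thesis
        using mult_left_mono[OF C[OF that], of "t powr (s - 1)"] by (simp add: norm_mult mult_ac)
    qed
  qed
qed

text \<open>These are the boundary terms of the integration by parts in
  \<open>has_integral_powr_expsum\<close>.\<close>

lemma powr_expsum_tendsto_0:
  assumes "\<And>k. k < m \<Longrightarrow> (\<Sum>j\<in>J. c j * z j ^ k) = 0"
    and "\<And>j. j \<in> J \<Longrightarrow> a \<le> Re (z j)" "a > 0" "s > - real m"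
  shows "((\<lambda>t. of_real (t powr s) * expsum J c z t) \<longlongrightarrow> 0) (at_right 0)"
    and "((\<lambda>t. of_real (t powr s) * expsum J c z t) \<longlongrightarrow> 0) at_top"
proof -
  obtain C where C: "\<And>t. t > 0 \<Longrightarrow> norm (expsum J c z t) \<le> C * (t ^ m * exp (- (a * t)))"
    using norm_expsum_le[OF assms(1,2)] assms(3) by (meson less_imp_le)
  have le: "norm (of_real (t powr s) * expsum J c z t) \<le> C * (t powr (s + m) * exp (- (a * t)))"
    if "t > 0" for t
  proof -
    have "t powr (s + m) = t powr s * t ^ m"
      using that by (simp add: powr_realpow[symmetric] powr_add)
    then show ?thesis
      using mult_left_mono[OF C[OF that], of "t powr s"] by (simp add: norm_mult mult_ac)
  qed
  have "((\<lambda>t. t powr (s + m) * exp (- (a * t))) \<longlongrightarrow> 0 powr (s + m) * exp (- (a * 0))) (at_right 0)"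
    using assms(4) by (intro tendsto_intros) (auto intro!: eventually_at_rightI[of 0 1])
  then have "((\<lambda>t. C * (t powr (s + m) * exp (- (a * t)))) \<longlongrightarrow> 0) (at_right 0)"
    using tendsto_mult_right_zero by force
  then show "((\<lambda>t. of_real (t powr s) * expsum J c z t) \<longlongrightarrow> 0) (at_right 0)"
    by (rule Lim_null_comparison[rotated]) (use le in \<open>auto intro!: eventually_at_rightI[of 0 1]\<close>)
  have "((\<lambda>t. C * (t powr (s + m) * exp (- (a * t)))) \<longlongrightarrow> 0) at_top"
    by (intro tendsto_mult_right_zero powr_exp_tendsto_0_at_top assms)
  then show "((\<lambda>t. of_real (t powr s) * expsum J c z t) \<longlongrightarrow> 0) at_top"
    by (rule Lim_null_comparison[rotated]) (use le in \<open>auto intro: eventually_mono[OF eventually_gt_at_top[of 0]]\<close>)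
qed

text \<open>Integration by parts raises the exponent \<open>s\<close> by one at the cost of one vanishing moment.\<close>

lemma has_integral_powr_expsum:
  assumes "finite J" and "\<And>k. k < m \<Longrightarrow> (\<Sum>j\<in>J. c j * z j ^ k) = 0"
    and "\<And>j. j \<in> J \<Longrightarrow> a \<le> Re (z j)" "a > 0" "s > - real m" "s \<notin> \<int>"
  shows "((\<lambda>t. of_real (t powr (s - 1)) * expsum J c z t) has_integral
     of_real (Gamma s) * (\<Sum>j\<in>J. c j * z j powr (- of_real s))) {0<..}"
  using assms(2,5,6)
proof (induction m arbitrary: s c)
  case 0
  \<comment> \<open>For \<open>m = 0\<close> the hypothesis reads \<open>s > 0\<close>, and each
    summand is a convergent Gamma integral.\<close>
  have "((\<lambda>t. \<Sum>j\<in>J. c j * laplace_powr s (z j) t) has_integral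
      (\<Sum>j\<in>J. c j * (of_real (Gamma s) * z j powr (- of_real s)))) {0<..}"
    using 0 assms by (intro has_integral_sum has_integral_mult_right has_integral_laplace_powr) force+
  then show ?case
    by (simp add: expsum_def laplace_powr_def sum_distrib_left mult_ac)
next
  case (Suc m)
  have s: "s \<noteq> 0" using Suc.prems by auto
  \<comment> \<open>Coefficients of the derivative of the sum: each moment of \<open>?c\<close> is
    minus the next moment of \<open>c\<close>.\<close>
  let ?c = "\<lambda>j. - c j * z j"
  let ?I = "of_real (Gamma (s + 1)) * (\<Sum>j\<in>J. ?c j * z j powr (- of_real (s + 1)))"
  have moments: "(\<Sum>j\<in>J. ?c j * z j ^ k) = 0" if "k < m" for k
    using Suc.prems(1)[of "Suc k"] that by (simp add: sum_negf mult_ac)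
  have IH: "((\<lambda>t. of_real (t powr (s + 1 - 1)) * expsum J ?c z t) has_integral ?I) {0<..}"
    using Suc.prems Ints_diff[of "s + 1" 1] by (intro Suc.IH moments) auto
  let ?f = "\<lambda>t. of_real (t powr s) * expsum J ?c z t + of_real s * (of_real (t powr (s - 1)) * expsum J c z t)"
  have abs: "(\<lambda>t. of_real (t powr (s - 1)) * expsum J c z t) absolutely_integrable_on {0<..}"
    using Suc.prems assms by (intro absolutely_integrable_powr_expsum[where m = "Suc m"]) auto
  have "(?f has_integral 0) {0<..}"
  proof (rule has_integral_Ioi_derivative)
    show "((\<lambda>t. of_real (t powr s) * expsum J c z t) has_vector_derivative ?f x) (at x)" if "x > 0" for x
      by (rule has_vector_derivative_eq_rhs[OF has_vector_derivative_mult[OF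
            has_vector_derivative_of_real_powr[OF that] has_vector_derivative_expsum]]) simp
    have "(\<lambda>t. of_real (t powr (s + 1 - 1)) * expsum J ?c z t) absolutely_integrable_on {0<..}"
      using Suc.prems(2) assms(3,4) by (intro absolutely_integrable_powr_expsum[where m = m and a = a] moments) auto
    then show "?f absolutely_integrable_on {0<..}"
      using abs by (intro set_integral_add set_integrable_mult_right) auto
    show "((\<lambda>t. of_real (t powr s) * expsum J c z t) \<longlongrightarrow> 0) (at_right 0)"
         "((\<lambda>t. of_real (t powr s) * expsum J c z t) \<longlongrightarrow> 0) at_top"
      using Suc.prems assms by (auto intro!: powr_expsum_tendsto_0[where m = "Suc m" and a = a])
  qed
  from has_integral_diff[OF this IH]
  have "((\<lambda>t. of_real s * (of_real (t powr (s - 1)) * expsum J c z t)) has_integral - ?I) {0<..}"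
    by simp
  from has_integral_mult_right[OF this, of "1 / of_real s"]
  have "((\<lambda>t. of_real (t powr (s - 1)) * expsum J c z t) has_integral - ?I / of_real s) {0<..}"
    using s by simp
  also have "- ?I / of_real s = of_real (Gamma s) * (\<Sum>j\<in>J. c j * z j powr (- of_real s))"
  proof -
    have "z j * z j powr (- of_real (s + 1)) = z j powr (- of_real s)" if "j \<in> J" for j
    proof -
      have "z j \<noteq> 0" using assms(3)[OF that] assms(4) by auto
      then show ?thesis
        using powr_add[of "z j" 1 "- of_real (s + 1)"] by simp
    qed
    then have "(\<Sum>j\<in>J. ?c j * z j powr (- of_real (s + 1))) = - (\<Sum>j\<in>J. c j * z j powr (- of_real s))"
      by (simp add: sum_negf mult.assoc)
    moreover have "Gamma (s + 1) = s * Gamma s"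
      using Suc.prems(3) by (intro Gamma_plus1) auto
    ultimately show ?thesis using s by simp
  qed
  finally show ?case .
qed

text \<open>On the imaginary axis there is no exponential decay. Near 0 the moments give
  \<open>t powr (m - b - 1)\<close>, integrable since \<open>b < m\<close>; beyond 1 the sum is
  merely bounded, and \<open>t powr (- b - 1)\<close> is integrable since
  \<open>b > 0\<close>.\<close>

lemma absolutely_integrable_powr_expsum_imaginary:
  assumes "\<And>k. k < m \<Longrightarrow> (\<Sum>j\<in>J. c j * (- (\<i> * of_real (a j))) ^ k) = 0"
    and "b > 0" "b < real m"
  shows "(\<lambda>t. of_real (t powr (- b - 1)) * expsum J c (\<lambda>j. - (\<i> * of_real (a j))) t) absolutely_integrable_on {0<..}"
    (is "(\<lambda>t. _ * ?h t) absolutely_integrable_on _")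
proof -
  obtain D where D: "D \<ge> 0" "\<And>t. t \<in> {0..1} \<Longrightarrow> norm (?h t) \<le> D * t ^ m"
    using norm_expsum_le_power[OF assms(1)] by blast
  define E where "E = (\<Sum>j\<in>J. norm (c j))"
  have E: "norm (?h t) \<le> E" if "t \<ge> 0" for t
    using norm_expsum_le_exp[of J 0 "\<lambda>j. - (\<i> * of_real (a j))" t c] that by (simp add: E_def)
  define g where "g = (\<lambda>t. if t \<le> 1 then D * t powr (m - b - 1) else E * t powr (- b - 1))"
  have "(\<lambda>t. D * t powr (m - b - 1)) integrable_on {0<..1}"
    using integrable_on_cmult_left[OF integrable_on_powr_from_0'[of "m - b - 1" 1], of D] assms by simp
  then have 1: "g integrable_on {0<..1}"
    by (rule integrable_eq) (auto simp: g_def)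
  have "(\<lambda>t. E * t powr (- b - 1)) integrable_on {1..}"
    using integrable_on_cmult_left[OF has_integral_integrable[OF has_integral_powr_to_inf[of "- b - 1" 1]], of E] assms
    by simp
  then have 2: "g integrable_on {1..}"
    by (rule integrable_spike_finite[of "{1}", rotated 2]) (auto simp: g_def)
  have "g integrable_on {0<..1} \<union> {1..}"
    by (rule integrable_Un[OF _ 1 2]) (rule negligible_subset[of "{1}"], auto)
  also have "{0<..1} \<union> {1..} = {0::real<..}" by auto
  finally have g: "g integrable_on {0<..}" .
  show ?thesis
  proof (rule absolutely_integrable_continuous_dominated[OF _ g])
    show "continuous_on {0<..} (\<lambda>t. of_real (t powr (- b - 1)) * ?h t)"
      by (intro continuous_intros continuous_on_expsum) auto
    fix t :: real assume t: "t > 0"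
    show "norm (of_real (t powr (- b - 1)) * ?h t) \<le> g t"
    proof (cases "t \<le> 1")
      case True
      have "t powr (m - b - 1) = t powr (- b - 1) * t ^ m"
        using t by (simp add: powr_realpow[symmetric] flip: powr_add) (simp add: algebra_simps)
      then show ?thesis
        using mult_left_mono[OF D(2)[of t], of "t powr (- b - 1)"] True t
        by (simp add: g_def norm_mult mult_ac)
    next
      case False
      then show ?thesis
        using mult_left_mono[OF E[of t], of "t powr (- b - 1)"] t
        by (simp add: g_def norm_mult mult_ac)
    qed
  qed
qed

text \<open>Limit of the previous case for \<open>z j = e - \<i> * a j\<close> as \<open>e\<close> decreases to 0.\<close>

lemma has_integral_powr_expsum_imaginary:
  fixes c :: "'a \<Rightarrow> complex" and a :: "'a \<Rightarrow> real"
  assumes "finite J"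
    and moments: "\<And>k e. k < m \<Longrightarrow> (\<Sum>j\<in>J. c j * (of_real e - \<i> * of_real (a j)) ^ k) = 0"
    and b: "b > 0" "b < real m" "b \<notin> \<int>"
  shows "((\<lambda>t. of_real (t powr (- b - 1)) * expsum J c (\<lambda>j. - (\<i> * of_real (a j))) t) has_integral
     of_real (Gamma (- b)) * (\<Sum>j\<in>J. c j * (- (\<i> * of_real (a j))) powr of_real b)) {0<..}"
    (is "(?f has_integral ?I) _")
proof -
  define e where "e = (\<lambda>n. inverse (real (Suc n)))"
  define z where "z = (\<lambda>n j. of_real (e n) - \<i> * of_real (a j))"
  have e0: "e n > 0" for n by (simp add: e_def)
  have elim: "e \<longlonglongrightarrow> 0" unfolding e_def by (rule LIMSEQ_inverse_real_of_nat)
  \<comment> \<open>The regularisation is just a damping factor \<open>exp (- (e n * t))\<close>, at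
    most 1, so the limit integrand itself dominates.\<close>
  have eq: "expsum J c (z n) t = of_real (exp (- (e n * t))) * expsum J c (\<lambda>j. - (\<i> * of_real (a j))) t" for n t
    unfolding expsum_def z_def sum_distrib_left
    by (intro sum.cong refl) (simp add: algebra_simps flip: exp_of_real exp_add)
  show ?thesis
  proof (rule has_integral_dominated_convergence)
    show "((\<lambda>t. of_real (t powr (- b - 1)) * expsum J c (z n) t) has_integral
       of_real (Gamma (- b)) * (\<Sum>j\<in>J. c j * z n j powr (- of_real (- b)))) {0<..}" for n
      using b moments[of _ "e n"] e0[of n] assms(1)
      by (intro has_integral_powr_expsum[where m = m and a = "e n"]) (auto simp: z_def)
    have "?f absolutely_integrable_on {0<..}"
      using b moments[of _ 0] by (intro absolutely_integrable_powr_expsum_imaginary[where m = m]) auto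
    then show "(\<lambda>t. norm (?f t)) integrable_on {0<..}"
      by (simp add: absolutely_integrable_on_def)
    show "\<forall>t\<in>{0<..}. norm (of_real (t powr (- b - 1)) * expsum J c (z n) t) \<le> norm (?f t)" for n
    proof
      fix t :: real assume t: "t \<in> {0<..}"
      have "exp (- (e n * t)) * norm (?f t) \<le> 1 * norm (?f t)"
        using t e0[of n] by (intro mult_right_mono) auto
      then show "norm (of_real (t powr (- b - 1)) * expsum J c (z n) t) \<le> norm (?f t)"
        by (simp add: eq norm_mult mult_ac)
    qed
    show "\<forall>t\<in>{0<..}. (\<lambda>n. of_real (t powr (- b - 1)) * expsum J c (z n) t) \<longlonglongrightarrow> ?f t"
    proof
      fix t :: real
      have "(\<lambda>n. of_real (t powr (- b - 1)) * (of_real (exp (- (e n * t))) * expsum J c (\<lambda>j. - (\<i> * of_real (a j))) t)) \<longlonglongrightarrow>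
          of_real (t powr (- b - 1)) * (of_real (exp (- (0 * t))) * expsum J c (\<lambda>j. - (\<i> * of_real (a j))) t)"
        by (intro tendsto_intros elim)
      then show "(\<lambda>n. of_real (t powr (- b - 1)) * expsum J c (z n) t) \<longlonglongrightarrow> ?f t"
        by (simp add: eq)
    qed
    \<comment> \<open>A nonzero imaginary limit lies off the branch cut. If \<open>a j = 0\<close>,
      the limit is the branch point 0, approached along the positive reals, where
      \<open>b > 0\<close> gives continuity.\<close>
    have lim: "(\<lambda>n. z n j powr of_real b) \<longlonglongrightarrow> (- (\<i> * of_real (a j))) powr of_real b" for j
    proof (cases "a j = 0")
      case True
      have "(\<lambda>n. e n powr b) \<longlonglongrightarrow> 0 powr b"
        using b e0 by (intro tendsto_intros elim) (auto intro!: always_eventually less_imp_le)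
      then have "(\<lambda>n. complex_of_real (e n powr b)) \<longlonglongrightarrow> 0"
        using b tendsto_of_real by fastforce
      then show ?thesis
        using True b e0 by (simp add: z_def powr_of_real less_imp_le)
    next
      case False
      have "(\<lambda>n. z n j) \<longlonglongrightarrow> of_real 0 - \<i> * of_real (a j)"
        unfolding z_def by (intro tendsto_intros elim)
      then show ?thesis
        using False by (intro tendsto_powr_complex) (auto simp: complex_nonpos_Reals_iff)
    qed
    show "(\<lambda>n. of_real (Gamma (- b)) * (\<Sum>j\<in>J. c j * z n j powr (- of_real (- b)))) \<longlonglongrightarrow> ?I"
      by (simp only: of_real_minus minus_minus) (intro tendsto_mult tendsto_const tendsto_sum lim)
  qed
qed

text \<open>The principal argument of \<open>- (\<i> * a)\<close> is
  \<open>- (pi / 2 * sgn a)\<close>. Nodes on the two sides of 0 get opposite phases, which later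
  separates the left from the right derivative.\<close>

lemma minus_i_powr:
  fixes a b :: real
  assumes "b > 0"
  shows "(- (\<i> * of_real a)) powr of_real b = of_real (\<bar>a\<bar> powr b) * cis (- (pi / 2 * b * sgn a))"
proof (cases "a = 0")
  case False
  have Ln: "Ln (- (\<i> * of_real a)) = of_real (ln \<bar>a\<bar>) + \<i> * of_real (- (pi / 2 * sgn a))"
  proof (rule Ln_unique)
    have "exp (complex_of_real (ln \<bar>a\<bar>) + \<i> * of_real (- (pi / 2 * sgn a))) = of_real \<bar>a\<bar> * cis (- (pi / 2 * sgn a))"
      using False by (simp only: exp_add cis_conv_exp exp_of_real) simp
    also have "\<dots> = - (\<i> * of_real a)"
      by (auto simp: sgn_if complex_eq_iff)
    finally show "exp (complex_of_real (ln \<bar>a\<bar>) + \<i> * of_real (- (pi / 2 * sgn a))) = - (\<i> * of_real a)" .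
  qed (use pi_gt_zero in \<open>auto simp: sgn_if simp del: pi_gt_zero\<close>)
  have "(- (\<i> * of_real a)) powr of_real b = exp (of_real (b * ln \<bar>a\<bar>) + \<i> * of_real (- (pi / 2 * b * sgn a)))"
    using False unfolding powr_def Ln by (simp add: algebra_simps)
  then show ?thesis
    using False by (simp only: exp_add powr_def cis_conv_exp exp_of_real) simp
qed (use assms in auto)

subsection \<open>Fractional derivatives of B-splines\<close>

text \<open>Truncated power expansion, by induction along the defining recursion. The conditional
  keeps degree 0 correct, where \<open>max 0 (t - real j) ^ 0\<close> would be 1 on both sides of
  the knot.\<close>

lemma bspline_eq_sum:
  "bspline q t = (\<Sum>j\<le>Suc q. (-1) ^ j * real (Suc q choose j) * (if real j \<le> t then (t - real j) ^ q else 0)) / fact q"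
proof (induction q arbitrary: t)
  case 0
  show ?case by (auto simp: indicator_def)
next
  case (Suc q)
  define d where "d = (\<lambda>j. if real j \<le> t then (t - real j) ^ q else 0)"
  \<comment> \<open>This distributes each coefficient over the two terms of the recursion: the
    absorption identity handles \<open>Suc i\<close> times the binomial coefficient, Pascal's rule
    the rest.\<close>
  have choose: "real (Suc (Suc q) choose Suc i) * (t - real (Suc i)) =
      t * real (Suc q choose Suc i) - (real q + 2 - t) * real (Suc q choose i)" for i
  proof -
    have "real (Suc i) * real (Suc (Suc q) choose Suc i) = real (Suc (Suc q)) * real (Suc q choose i)"
      by (simp only: Suc_times_binomial_eq flip: of_nat_mult) (simp add: mult.commute)
    moreover have "real (Suc (Suc q) choose Suc i) = real (Suc q choose i) + real (Suc q choose Suc i)"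
      by simp
    ultimately show ?thesis by (simp add: algebra_simps)
  qed
  \<comment> \<open>An added term with binomial coefficient 0 aligns the summation ranges.\<close>
  have 1: "(\<Sum>j\<le>Suc q. (-1) ^ j * real (Suc q choose j) * d j) =
      d 0 + (\<Sum>i\<le>Suc q. (-1) ^ Suc i * real (Suc q choose Suc i) * d (Suc i))"
  proof -
    have "(\<Sum>j\<le>Suc q. (-1) ^ j * real (Suc q choose j) * d j) =
      (\<Sum>j\<le>Suc (Suc q). (-1) ^ j * real (Suc q choose j) * d j)"
      by (simp add: binomial_eq_0 del: binomial_Suc_Suc)
    then show ?thesis
      by (simp only: sum.atMost_Suc_shift[of _ "Suc q"]) simp
  qed
  have "(\<Sum>j\<le>Suc (Suc q). (-1) ^ j * real (Suc (Suc q) choose j) * (if real j \<le> t then (t - real j) ^ Suc q else 0))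
      = (\<Sum>j\<le>Suc (Suc q). (-1) ^ j * (real (Suc (Suc q) choose j) * (t - real j)) * d j)"
    by (intro sum.cong) (auto simp: d_def)
  also have "\<dots> = t * d 0 + (\<Sum>i\<le>Suc q. (-1) ^ Suc i * (t * real (Suc q choose Suc i) - (real q + 2 - t) * real (Suc q choose i)) * d (Suc i))"
    by (simp only: sum.atMost_Suc_shift[of _ "Suc q"] choose) simp
  also have "\<dots> = t * (d 0 + (\<Sum>i\<le>Suc q. (-1) ^ Suc i * real (Suc q choose Suc i) * d (Suc i)))
      + (real q + 2 - t) * (\<Sum>i\<le>Suc q. (-1) ^ i * real (Suc q choose i) * d (Suc i))"
    by (simp only: sum_distrib_left distrib_left add.assoc flip: sum.distrib) (simp add: algebra_simps)
  also have "(\<Sum>i\<le>Suc q. (-1) ^ i * real (Suc q choose i) * d (Suc i)) = fact q * bspline q (t - 1)"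
  proof -
    have "d (Suc i) = (if real i \<le> t - 1 then (t - 1 - real i) ^ q else 0)" for i
      by (simp add: d_def algebra_simps)
    then show ?thesis by (simp add: Suc.IH del: sum.atMost_Suc)
  qed
  also have "d 0 + (\<Sum>i\<le>Suc q. (-1) ^ Suc i * real (Suc q choose Suc i) * d (Suc i)) = fact q * bspline q t"
    unfolding 1[symmetric] by (simp add: Suc.IH d_def del: sum.atMost_Suc)
  finally have "(\<Sum>j\<le>Suc (Suc q). (-1) ^ j * real (Suc (Suc q) choose j) * (if real j \<le> t then (t - real j) ^ Suc q else 0)) / fact (Suc q)
      = (t * (fact q * bspline q t) + (real q + 2 - t) * (fact q * bspline q (t - 1))) / (real (Suc q) * fact q)"
    by (simp only: fact_Suc)
  also have "\<dots> = t / real (Suc q) * bspline q t + (real (Suc q) + 1 - t) / real (Suc q) * bspline q (t - 1)"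
  proof -
    have "(t * (F * B) + (m + 1 - t) * (F * C)) / (m * F) = t / m * B + (m + 1 - t) / m * C"
      if "F \<noteq> 0" "m \<noteq> 0" for F B C m :: real
      using that by (simp add: divide_simps) (simp add: algebra_simps)
    from this[of "fact q" "real (Suc q)"] show ?thesis by (simp add: add.commute)
  qed
  finally show ?case by (simp only: bspline.simps)
qed

lemma bspline_eq:
  assumes "q \<ge> 1"
  shows "bspline q t = (\<Sum>j\<le>Suc q. (-1) ^ j * real (Suc q choose j) * max 0 (t - real j) ^ q) / fact q"
  unfolding bspline_eq_sum using assms
  by (intro arg_cong[where f = "\<lambda>x. x / fact q"] sum.cong) (auto simp: max_def)

text \<open>Degree 0 is left out because the half-open indicator is not symmetric. In the induction
  step the reflection swaps the two terms of the recursion.\<close>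

lemma bspline_reflect: "bspline (Suc q) (real (Suc q) + 1 - t) = bspline (Suc q) t"
proof (induction q arbitrary: t)
  case 0
  show ?case by (auto simp: indicator_def)
next
  case (Suc q)
  have 1: "bspline (Suc q) (real (Suc (Suc q)) + 1 - t) = bspline (Suc q) (t - 1)"
    using Suc.IH[of "t - 1"] by (simp add: algebra_simps)
  have 2: "bspline (Suc q) (real (Suc (Suc q)) + 1 - t - 1) = bspline (Suc q) t"
    using Suc.IH[of t] by (simp add: algebra_simps)
  show ?case
    unfolding bspline.simps(2)[of "Suc q"] 1 2 by simp
qed

text \<open>Left of the support every truncated power vanishes; the right side follows by
  reflection.\<close>

lemma bspline_eq_0:
  assumes "q \<ge> 1" "t < 0 \<or> t > real q + 1"
  shows "bspline q t = 0"
proof -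
  have neg: "bspline q t = 0" if "t < 0" for t
  proof -
    have "max 0 (t - real j) ^ q = 0" for j
      using that assms(1) by (simp add: max_def)
    then show ?thesis unfolding bspline_eq[OF assms(1)] by (simp only:) simp
  qed
  obtain r where "q = Suc r" using assms(1) by (cases q) auto
  then show ?thesis
    using assms(2) neg[of t] neg[of "real q + 1 - t"] bspline_reflect[of r t] by auto
qed

text \<open>The substitution \<open>y = c + (z - c) * t\<close> reduces this to the Beta integral
  over the unit interval; for \<open>z \<le> c\<close> the integrand is 0.\<close>

lemma has_integral_powr_times_power:
  fixes s z c :: real
  assumes "s > -1" "q \<ge> 1"
  shows "((\<lambda>y. (z - y) powr s * max 0 (y - c) ^ q) has_integral
           Beta (s + 1) (real q + 1) * max 0 (z - c) powr (s + 1 + real q)) {..z}"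
proof (cases "z \<le> c")
  case True
  have "(z - y) powr s * max 0 (y - c) ^ q = 0" if "y \<in> {..z}" for y
    using that True assms by (auto simp: max_def)
  then have "((\<lambda>y. (z - y) powr s * max 0 (y - c) ^ q) has_integral 0) {..z}"
    by (rule has_integral_is_0)
  moreover have "max 0 (z - c) = 0" using True by simp
  ultimately show ?thesis by simp
next
  case False
  define w where "w = z - c"
  have w: "w > 0" using False by (simp add: w_def)
  let ?b = "\<lambda>t. t powr (real q + 1 - 1) * (1 - t) powr (s + 1 - 1)"
  have beta: "(?b has_integral Beta (real q + 1) (s + 1)) (cbox 0 1)"
    using has_integral_Beta_real[of "real q + 1" "s + 1"] assms by simp
  have "(c * w + w * w) / w = c + w" using w by (simp add: field_simps)
  then have ivl: "(c * w + w * w) / w = z" by (simp add: w_def)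
  from has_integral_affinity'[OF beta, of "1 / w" "- c / w"] w
  have "((\<lambda>y. ?b ((1 / w) * y + - c / w)) has_integral w * Beta (s + 1) (real q + 1)) {c..z}"
    by (simp add: Beta_commute field_simps ivl)
  from has_integral_mult_right[OF this, of "w powr (s + real q)"]
  have "((\<lambda>y. w powr (s + real q) * ?b ((1 / w) * y + - c / w)) has_integral
      Beta (s + 1) (real q + 1) * w powr (s + 1 + real q)) {c..z}"
    using w by (simp add: powr_add mult_ac)
  then have "((\<lambda>y. (z - y) powr s * max 0 (y - c) ^ q) has_integral
      Beta (s + 1) (real q + 1) * w powr (s + 1 + real q)) {c..z}"
  proof (rule has_integral_eq[rotated])
    fix y assume y: "y \<in> {c..z}"
    have "(1 / w) * y + - c / w = (y - c) / w" "1 - ((1 / w) * y + - c / w) = (z - y) / w"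
      using w by (simp_all add: field_simps) (simp add: w_def)
    then have "?b ((1 / w) * y + - c / w) = ((y - c) / w) powr real q * ((z - y) / w) powr s"
      by simp
    also have "\<dots> = (y - c) ^ q / w powr real q * ((z - y) powr s / w powr s)"
      using y w assms by (cases "y = c") (simp_all add: powr_divide powr_realpow)
    finally show "w powr (s + real q) * ?b ((1 / w) * y + - c / w) = (z - y) powr s * max 0 (y - c) ^ q"
      using y w by (simp add: powr_add)
  qed
  then have "((\<lambda>y. if y \<in> {c..z} then (z - y) powr s * max 0 (y - c) ^ q else 0) has_integral
      Beta (s + 1) (real q + 1) * w powr (s + 1 + real q)) {..z}"
    by (subst has_integral_restrict) auto
  then have "((\<lambda>y. (z - y) powr s * max 0 (y - c) ^ q) has_integral
      Beta (s + 1) (real q + 1) * w powr (s + 1 + real q)) {..z}"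
    by (rule has_integral_eq[rotated]) (use assms in \<open>auto simp: max_def\<close>)
  then show ?thesis using w by (simp add: w_def)
qed

text \<open>Away from \<open>c\<close> the function is a power or locally constant. At the kink the
  difference quotient is at most \<open>\<bar>h\<bar> powr (r - 1)\<close>, which tends to 0 because
  \<open>r > 1\<close>.\<close>

lemma has_real_derivative_max_powr:
  fixes r :: real
  assumes "r > 1"
  shows "((\<lambda>x. max 0 (x - c) powr r) has_real_derivative r * max 0 (x - c) powr (r - 1)) (at x)"
proof -
  consider "x > c" | "x < c" | "x = c" by linarith
  then show ?thesis
  proof cases
    case 1
    have "((\<lambda>x. (x - c) powr r) has_real_derivative r * (x - c) powr (r - 1)) (at x)"
      using 1 by (auto intro!: derivative_eq_intros)
    moreover have "\<forall>\<^sub>F y in nhds x. (y - c) powr r = max 0 (y - c) powr r"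
      using eventually_nhds_in_open[of "{c<..}" x] 1 by (auto elim!: eventually_mono)
    ultimately show ?thesis using 1 by (auto simp: DERIV_cong_ev[OF refl _ refl] max_def)
  next
    case 2
    have "\<forall>\<^sub>F y in nhds x. 0 = max 0 (y - c) powr r"
      using eventually_nhds_in_open[of "{..<c}" x] 2 by (auto elim!: eventually_mono)
    then have "((\<lambda>x. max 0 (x - c) powr r) has_real_derivative 0) (at x)"
      using DERIV_cong_ev[OF refl _ refl, of "\<lambda>_. 0" "\<lambda>x. max 0 (x - c) powr r" x 0] by simp
    then show ?thesis using 2 by simp
  next
    case 3
    have lim: "((\<lambda>h. \<bar>h\<bar> powr (r - 1)) \<longlongrightarrow> \<bar>0\<bar> powr (r - 1)) (at (0::real))"
      using assms by (intro tendsto_intros) auto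
    have "((\<lambda>h. (max 0 (c + h - c) powr r - max 0 (c - c) powr r) / h) \<longlongrightarrow> 0) (at 0)"
    proof (rule Lim_null_comparison)
      show "\<forall>\<^sub>F h in at 0. norm ((max 0 (c + h - c) powr r - max 0 (c - c) powr r) / h) \<le> \<bar>h\<bar> powr (r - 1)"
      proof (intro always_eventually allI)
        fix h :: real
        show "norm ((max 0 (c + h - c) powr r - max 0 (c - c) powr r) / h) \<le> \<bar>h\<bar> powr (r - 1)"
          by (cases "h > 0") (auto simp: max_def powr_diff intro!: divide_nonneg_neg)
      qed
    qed (use lim in simp)
    then show ?thesis using 3 by (simp add: DERIV_def)
  qed
qed

text \<open>The Riemann-Liouville derivative of order \<open>p - r\<close> of the B-spline of degree \<open>p\<close>.\<close>

definition frac_spline :: "nat \<Rightarrow> real \<Rightarrow> real \<Rightarrow> real" where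
  "frac_spline p r x = (\<Sum>j\<le>Suc p. (-1) ^ j * real (Suc p choose j) * max 0 (x - real j) powr r) / Gamma (r + 1)"

text \<open>The factor \<open>r\<close> from the power rule is absorbed by the normalisation with
  \<open>Gamma (r + 1)\<close>.\<close>

lemma DERIV_frac_spline:
  assumes "r > 1"
  shows "(frac_spline p r has_real_derivative frac_spline p (r - 1) x) (at x)"
proof -
  have "Gamma (r + 1) = r * Gamma r" using assms by (intro Gamma_plus1) (auto elim!: nonpos_Ints_cases)
  moreover have "Gamma r > 0" using assms by (intro Gamma_real_pos) simp
  ultimately have "frac_spline p (r - 1) x = (\<Sum>j\<le>Suc p. (-1) ^ j * real (Suc p choose j) *
      (r * max 0 (x - real j) powr (r - 1))) / Gamma (r + 1)"
    using assms unfolding frac_spline_def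
    by (simp add: sum_divide_distrib mult.assoc del: sum.atMost_Suc)
  moreover have "(frac_spline p r has_real_derivative (\<Sum>j\<le>Suc p. (-1) ^ j * real (Suc p choose j) *
      (r * max 0 (x - real j) powr (r - 1))) / Gamma (r + 1)) (at x)"
    unfolding frac_spline_def[abs_def]
    by (intro DERIV_cdivide DERIV_sum DERIV_cmult has_real_derivative_max_powr assms)
  ultimately show ?thesis by simp
qed

text \<open>In each truncated power the Beta value contributes \<open>fact q\<close>, which cancels
  the denominator of the B-spline, and \<open>1 / Gamma (s + 1 + real q + 1)\<close>, which is the
  normalisation of \<open>frac_spline\<close>.\<close>

lemma integral_bspline:
  assumes "q \<ge> 1" "s > -1"
  shows "integral {..z} (\<lambda>y. (z - y) powr s * bspline q y) = Gamma (s + 1) * frac_spline q (s + 1 + real q) z"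
proof (rule integral_unique)
  have "((\<lambda>y. (\<Sum>j\<le>Suc q. ((-1) ^ j * real (Suc q choose j)) * ((z - y) powr s * max 0 (y - real j) ^ q)) / fact q) has_integral
    (\<Sum>j\<le>Suc q. ((-1) ^ j * real (Suc q choose j)) * (Beta (s + 1) (real q + 1) * max 0 (z - real j) powr (s + 1 + real q))) / fact q) {..z}"
    using assms
    by (intro has_integral_divide has_integral_sum has_integral_mult_right has_integral_powr_times_power) auto
  moreover have "Beta (s + 1) (real q + 1) = fact q * Gamma (s + 1) / Gamma (s + 1 + real q + 1)"
    by (simp add: Beta_def Gamma_fact add_ac)
  ultimately show "((\<lambda>y. (z - y) powr s * bspline q y) has_integral Gamma (s + 1) * frac_spline q (s + 1 + real q) z) {..z}"
    unfolding bspline_eq[OF assms(1)] frac_spline_def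
    by (simp add: sum_distrib_left sum_divide_distrib mult_ac del: sum.atMost_Suc)
qed

text \<open>This is the reflection \<open>y \<mapsto> q + 1 - y\<close> combined with the symmetry
  of the B-spline. The bounded support first cuts both integrals down to compact intervals, where
  the change of variables is made.\<close>

lemma integral_bspline_right:
  assumes "q \<ge> 1"
  shows "integral {z..} (\<lambda>y. (y - z) powr s * bspline q y)
       = integral {..real q + 1 - z} (\<lambda>y. (real q + 1 - z - y) powr s * bspline q y)"
proof -
  define w where "w = real q + 1 - z"
  let ?F = "\<lambda>y. (w - y) powr s * bspline q y"
  obtain r where r: "q = Suc r" using assms by (cases q) auto
  have "integral {..w} ?F = integral {0..w} ?F"
    using bspline_eq_0[OF assms]
    by (subst (1 2) integral_restrict_UNIV[symmetric]) (intro arg_cong2[where f = integral] refl ext, auto)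
  moreover have "integral {z..} (\<lambda>y. (y - z) powr s * bspline q y) = integral {z..real q + 1} (\<lambda>y. (y - z) powr s * bspline q y)"
    using bspline_eq_0[OF assms]
    by (subst (1 2) integral_restrict_UNIV[symmetric]) (intro arg_cong2[where f = integral] refl ext, auto)
  moreover have "integral {z..real q + 1} (\<lambda>y. (y - z) powr s * bspline q y) = integral {z..real q + 1} (\<lambda>y. ?F (- y + (real q + 1)))"
    using bspline_reflect[of r] r by (intro integral_cong) (simp add: w_def algebra_simps)
  moreover have "integral {z..real q + 1} (\<lambda>y. ?F (- y + (real q + 1))) = integral {0..w} ?F"
  proof -
    have "integral {0..w} ?F = integral {- w..-0} (\<lambda>y. ?F (- y))"
      by (rule Henstock_Kurzweil_Integration.integral_reflect_real[symmetric])
    also have "\<dots> = integral {- w..-0} ((\<lambda>y. ?F (- y + (real q + 1))) \<circ> (+) (real q + 1))"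
      by (intro integral_cong) (simp add: o_def)
    also have "\<dots> = integral {- w + (real q + 1)..- 0 + (real q + 1)} (\<lambda>y. ?F (- y + (real q + 1)))"
      by (rule integral_shift_Icc_real)
    finally show ?thesis by (simp add: w_def)
  qed
  ultimately show ?thesis by (simp add: w_def)
qed

text \<open>Here \<open>m = 2\<close>: the fractional integral is a spline of exponent
  \<open>p + 2 - \<alpha>\<close>, lowered to \<open>p - \<alpha>\<close> by two differentiations.
  The second one requires \<open>p + 1 - \<alpha> > 1\<close>, which \<open>2 \<le> p\<close> and
  \<open>\<alpha> < 2\<close> provide.\<close>

lemma RL_bspline:
  assumes "1 < \<alpha>" "\<alpha> < 2" "2 \<le> p"
  shows "RL_left \<alpha> (bspline p) x = frac_spline p (real p - \<alpha>) x"
    and "RL_right \<alpha> (bspline p) x = frac_spline p (real p - \<alpha>) (real p + 1 - x)"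
proof -
  have fl: "nat (\<lfloor>\<alpha>\<rfloor> + 1) = 2"
    using assms by (simp add: floor_eq_iff nat_eq_iff)
  have dd: "(deriv ^^ 2) F = deriv (deriv F)" for F :: "real \<Rightarrow> real"
    by (simp add: numeral_2_eq_2)
  have r: "real p + 2 - \<alpha> - 1 - 1 = real p - \<alpha>" by simp
  let ?r = "real p + 2 - \<alpha>"
  let ?g = "Gamma (2 - \<alpha>)"
  have "?g > 0" using assms by (intro Gamma_real_pos) simp
  then have g: "?g \<noteq> 0" by simp
  have L: "(\<lambda>z. integral {..z} (\<lambda>y. (z - y) powr (2 - \<alpha> - 1) * bspline p y)) = (\<lambda>z. ?g * frac_spline p ?r z)"
    using integral_bspline[of p "2 - \<alpha> - 1"] assms by (simp add: algebra_simps)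
  have R: "(\<lambda>z. integral {z..} (\<lambda>y. (y - z) powr (2 - \<alpha> - 1) * bspline p y)) = (\<lambda>z. ?g * frac_spline p ?r (real p + 1 - z))"
    using integral_bspline_right[of p _ "2 - \<alpha> - 1"] fun_cong[OF L] assms by simp
  have D1: "(frac_spline p ?r has_real_derivative frac_spline p (?r - 1) x) (at x)"
    and D2: "(frac_spline p (?r - 1) has_real_derivative frac_spline p (?r - 1 - 1) x) (at x)" for x
    by (rule DERIV_frac_spline, use assms in simp)+
  note D1' = DERIV_chain2[OF D1] and D2' = DERIV_chain2[OF D2]
  have "deriv (\<lambda>z. ?g * frac_spline p ?r z) = (\<lambda>z. ?g * frac_spline p (?r - 1) z)"
    by (intro ext DERIV_imp_deriv DERIV_cmult D1)
  moreover have "deriv (\<lambda>z. ?g * frac_spline p (?r - 1) z) = (\<lambda>z. ?g * frac_spline p (?r - 1 - 1) z)"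
    by (intro ext DERIV_imp_deriv DERIV_cmult D2)
  ultimately show "RL_left \<alpha> (bspline p) x = frac_spline p (real p - \<alpha>) x"
    unfolding RL_left_def Let_def fl dd of_nat_numeral L r using g by simp
  \<comment> \<open>Each differentiation in \<open>z\<close> of a function of
    \<open>p + 1 - z\<close> yields a factor -1; the two factors cancel.\<close>
  have "deriv (\<lambda>z. ?g * frac_spline p ?r (real p + 1 - z)) = (\<lambda>z. ?g * (frac_spline p (?r - 1) (real p + 1 - z) * (0 - 1)))"
    by (intro ext DERIV_imp_deriv DERIV_cmult D1' derivative_intros)
  moreover have "deriv (\<lambda>z. ?g * (frac_spline p (?r - 1) (real p + 1 - z) * (0 - 1)))
      = (\<lambda>z. ?g * (frac_spline p (?r - 1 - 1) (real p + 1 - z) * (0 - 1) * (0 - 1)))"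
    by (intro ext DERIV_imp_deriv DERIV_cmult DERIV_cmult_right D2' derivative_intros)
  ultimately show "RL_right \<alpha> (bspline p) x = frac_spline p (real p - \<alpha>) (real p + 1 - x)"
    unfolding RL_right_def Let_def fl dd of_nat_numeral R r using g by simp
qed

text \<open>Reversing the summation index brings the reflected spline back to the knots
  \<open>real j\<close>, so that it can be compared termwise with the unreflected one.\<close>

lemma frac_spline_reflect:
  "frac_spline p r (real p + 1 - x) =
     (\<Sum>j\<le>Suc p. (-1) ^ Suc p * ((-1) ^ j * real (Suc p choose j)) * max 0 (real j - x) powr r) / Gamma (r + 1)"
proof -
  have "(\<Sum>j\<le>Suc p. (-1) ^ j * real (Suc p choose j) * max 0 (real p + 1 - x - real j) powr r) =
        (\<Sum>j\<le>Suc p. (-1) ^ (Suc p - j) * real (Suc p choose (Suc p - j)) * max 0 (real p + 1 - x - real (Suc p - j)) powr r)"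
    by (rule sum.reindex_bij_witness[of _ "\<lambda>j. Suc p - j" "\<lambda>j. Suc p - j"]) auto
  also have "\<dots> = (\<Sum>j\<le>Suc p. (-1) ^ Suc p * ((-1) ^ j * real (Suc p choose j)) * max 0 (real j - x) powr r)"
  proof (intro sum.cong refl)
    fix j assume j: "j \<in> {..Suc p}"
    have "(-1 :: real) ^ (Suc p - j) = (-1) ^ Suc p * (-1) ^ j"
      using j by (metis atMost_iff neg_one_power_add_eq_neg_one_power_diff power_add)
    moreover have "Suc p choose (Suc p - j) = Suc p choose j"
      using j by (intro binomial_symmetric[symmetric]) auto
    moreover have "real p + 1 - x - real (Suc p - j) = real j - x"
      using j by (simp add: of_nat_diff)
    ultimately show "(-1) ^ (Suc p - j) * real (Suc p choose (Suc p - j)) * max 0 (real p + 1 - x - real (Suc p - j)) powr r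
      = (-1) ^ Suc p * ((-1) ^ j * real (Suc p choose j)) * max 0 (real j - x) powr r" by simp
  qed
  finally show ?thesis unfolding frac_spline_def by simp
qed

subsection \<open>Periodization of the symbol\<close>

lemma summable_on_int_powr:
  assumes "s > 1"
  shows "(\<lambda>l::int. real_of_int \<bar>l\<bar> powr - s) summable_on UNIV"
proof -
  let ?f = "\<lambda>l::int. real_of_int \<bar>l\<bar> powr - s"
  have "summable (\<lambda>n. real n powr - s)" using assms by (simp add: summable_real_powr_iff)
  then have nat: "(\<lambda>n. real n powr - s) summable_on UNIV"
    by (intro norm_summable_imp_summable_on) simp
  have "?f summable_on range int"
    using nat by (subst summable_on_reindex) (simp_all add: o_def)
  moreover have "?f summable_on range (\<lambda>n. - int n)"
    using nat by (subst summable_on_reindex) (simp_all add: o_def inj_on_def)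
  ultimately have "?f summable_on (range int \<union> range (\<lambda>n. - int n))"
    by (rule summable_on_union)
  also have "range int \<union> range (\<lambda>n. - int n) = UNIV"
    by (auto intro: int_cases2)
  finally show ?thesis .
qed

text \<open>At \<open>\<xi> = 0\<close> the quotient is 0 by convention, which is harmless because \<open>0 powr \<alpha> = 0\<close>.\<close>

definition line_symbol :: "nat \<Rightarrow> real \<Rightarrow> real \<Rightarrow> real" where
  "line_symbol p \<alpha> \<xi> = \<bar>\<xi>\<bar> powr \<alpha> * (sin (\<xi> / 2) / (\<xi> / 2)) ^ (p + 1)"

lemma line_symbol_minus: "line_symbol p \<alpha> (- \<xi>) = line_symbol p \<alpha> \<xi>"
  by (simp add: line_symbol_def)

lemma symbol_f_eq_line_symbol: "symbol_f p \<alpha> \<theta> = (\<Sum>\<^sub>\<infinity>l::int. line_symbol p \<alpha> (\<theta> + 2 * real_of_int l * pi))"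
  unfolding symbol_f_def line_symbol_def by (simp add: add_divide_distrib)

text \<open>The two bounds come from \<open>\<bar>sin u\<bar> \<le> \<bar>u\<bar>\<close> and
  \<open>\<bar>sin u\<bar> \<le> 1\<close>: one controls the central period, the other the
  decay.\<close>

lemma abs_line_symbol_le:
  "\<bar>line_symbol p \<alpha> \<xi>\<bar> \<le> \<bar>\<xi>\<bar> powr \<alpha>"
  "\<xi> \<noteq> 0 \<Longrightarrow> \<bar>line_symbol p \<alpha> \<xi>\<bar> \<le> 2 ^ (p + 1) * \<bar>\<xi>\<bar> powr (\<alpha> - real (p + 1))"
proof -
  have "\<bar>sin (\<xi> / 2) / (\<xi> / 2)\<bar> \<le> 1"
    using abs_sin_x_le_abs_x[of "\<xi> / 2"] by (cases "\<xi> = 0") (simp_all add: abs_divide)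
  then have "\<bar>sin (\<xi> / 2) / (\<xi> / 2)\<bar> ^ (p + 1) \<le> 1"
    by (intro power_le_one) auto
  from mult_left_mono[OF this, of "\<bar>\<xi>\<bar> powr \<alpha>"]
  show "\<bar>line_symbol p \<alpha> \<xi>\<bar> \<le> \<bar>\<xi>\<bar> powr \<alpha>"
    unfolding line_symbol_def abs_mult power_abs by simp
  assume nz: "\<xi> \<noteq> 0"
  have "\<bar>sin (\<xi> / 2)\<bar> / \<bar>\<xi> / 2\<bar> \<le> 1 / \<bar>\<xi> / 2\<bar>"
    by (intro divide_right_mono) auto
  then have "\<bar>sin (\<xi> / 2) / (\<xi> / 2)\<bar> \<le> 2 / \<bar>\<xi>\<bar>"
    by (simp add: abs_divide)
  then have "\<bar>sin (\<xi> / 2) / (\<xi> / 2)\<bar> ^ (p + 1) \<le> (2 / \<bar>\<xi>\<bar>) ^ (p + 1)"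
    by (intro power_mono) auto
  from mult_left_mono[OF this, of "\<bar>\<xi>\<bar> powr \<alpha>"]
  have "\<bar>line_symbol p \<alpha> \<xi>\<bar> \<le> \<bar>\<xi>\<bar> powr \<alpha> * (2 / \<bar>\<xi>\<bar>) ^ (p + 1)"
    unfolding line_symbol_def abs_mult power_abs by simp
  also have "\<dots> = 2 ^ (p + 1) * \<bar>\<xi>\<bar> powr (\<alpha> - real (p + 1))"
  proof -
    have "\<bar>\<xi>\<bar> powr real (p + 1) = \<bar>\<xi>\<bar> ^ (p + 1)" using nz by (intro powr_realpow) simp
    then show ?thesis by (simp only: powr_diff power_divide) (simp only: times_divide_eq_right mult.commute)
  qed
  finally show "\<bar>line_symbol p \<alpha> \<xi>\<bar> \<le> 2 ^ (p + 1) * \<bar>\<xi>\<bar> powr (\<alpha> - real (p + 1))" .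
qed

text \<open>For \<open>l \<noteq> 0\<close> the shifted point has modulus at least
  \<open>(2 * \<bar>l\<bar> - 1) * pi\<close>, hence at least \<open>\<bar>l\<bar>\<close>. For
  \<open>l = 0\<close> the power of \<open>\<bar>l\<bar>\<close> is 0 by convention and the extra
  summand takes over. The majorant is summable because \<open>p + 1 - \<alpha> > 1\<close>.\<close>

lemma abs_line_symbol_shift_le:
  assumes \<alpha>: "1 < \<alpha>" "\<alpha> < 2" "2 \<le> p" and \<theta>: "\<bar>\<theta>\<bar> \<le> pi"
  shows "\<bar>line_symbol p \<alpha> (\<theta> + 2 * real_of_int l * pi)\<bar>
    \<le> (if l = 0 then pi powr \<alpha> else 0) + 2 ^ (p + 1) * real_of_int \<bar>l\<bar> powr - (real (p + 1) - \<alpha>)"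
proof (cases "l = 0")
  case True
  have "\<bar>line_symbol p \<alpha> \<theta>\<bar> \<le> \<bar>\<theta>\<bar> powr \<alpha>" by (rule abs_line_symbol_le)
  also have "\<dots> \<le> pi powr \<alpha>" using \<theta> \<alpha> by (intro powr_mono2) auto
  finally show ?thesis using True by simp
next
  case False
  let ?\<xi> = "\<theta> + 2 * real_of_int l * pi"
  have l: "real_of_int \<bar>l\<bar> \<ge> 1" using False by linarith
  have "real_of_int \<bar>l\<bar> * 1 \<le> (2 * real_of_int \<bar>l\<bar> - 1) * pi"
    using l pi_ge_two by (intro mult_mono) auto
  also have "\<dots> \<le> \<bar>2 * real_of_int l * pi\<bar> - \<bar>\<theta>\<bar>"
    using \<theta> by (simp add: abs_mult algebra_simps)
  also have "\<dots> \<le> \<bar>?\<xi>\<bar>" by linarith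
  finally have ge: "real_of_int \<bar>l\<bar> \<le> \<bar>?\<xi>\<bar>" by simp
  then have nz: "?\<xi> \<noteq> 0" using l by linarith
  have "\<bar>line_symbol p \<alpha> ?\<xi>\<bar> \<le> 2 ^ (p + 1) * \<bar>?\<xi>\<bar> powr (\<alpha> - real (p + 1))"
    by (rule abs_line_symbol_le(2)[OF nz])
  also have "\<dots> \<le> 2 ^ (p + 1) * real_of_int \<bar>l\<bar> powr (\<alpha> - real (p + 1))"
    using ge l \<alpha> by (intro mult_left_mono powr_mono2') auto
  finally show ?thesis using False by simp
qed

text \<open>One summable majorant \<open>M\<close>, independent of \<theta>, gives both claims. They
  are the bound and the limit for dominated convergence over a period; symmetric sums are chosen
  because they unfold to integrals over symmetric intervals.\<close>

lemma line_symbol_partial_sums: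
  assumes "1 < \<alpha>" "\<alpha> < 2" "2 \<le> p"
  shows "\<exists>B. \<forall>N \<theta>. \<bar>\<theta>\<bar> \<le> pi \<longrightarrow>
      \<bar>\<Sum>l=-int N..int N. line_symbol p \<alpha> (\<theta> + 2 * real_of_int l * pi)\<bar> \<le> B"
    and "\<bar>\<theta>\<bar> \<le> pi \<Longrightarrow> (\<lambda>N. \<Sum>l=-int N..int N. line_symbol p \<alpha> (\<theta> + 2 * real_of_int l * pi))
        \<longlonglongrightarrow> symbol_f p \<alpha> \<theta>"
proof -
  define M where "M = (\<lambda>l::int. (if l = 0 then pi powr \<alpha> else 0) + 2 ^ (p + 1) * real_of_int \<bar>l\<bar> powr - (real (p + 1) - \<alpha>))"
  have M0: "M l \<ge> 0" for l unfolding M_def by (intro add_nonneg_nonneg mult_nonneg_nonneg) auto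
  have "(\<lambda>l::int. if l = 0 then pi powr \<alpha> else 0) summable_on UNIV"
    by (rule finite_nonzero_values_imp_summable_on) (rule finite_subset[of _ "{0}"], auto)
  then have M: "M summable_on UNIV"
    unfolding M_def using assms by (intro summable_on_add summable_on_cmult_right summable_on_int_powr) auto
  have le: "norm (line_symbol p \<alpha> (\<theta> + 2 * real_of_int l * pi)) \<le> M l" if "\<bar>\<theta>\<bar> \<le> pi" for \<theta> l
    unfolding M_def real_norm_def by (rule abs_line_symbol_shift_le[OF assms that])
  have "\<bar>\<Sum>l=-int N..int N. line_symbol p \<alpha> (\<theta> + 2 * real_of_int l * pi)\<bar> \<le> infsum M UNIV" if "\<bar>\<theta>\<bar> \<le> pi" for \<theta> N
  proof -
    have "\<bar>\<Sum>l=-int N..int N. line_symbol p \<alpha> (\<theta> + 2 * real_of_int l * pi)\<bar> \<le> (\<Sum>l=-int N..int N. M l)"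
      using sum_norm_le[of "{-int N..int N}", OF le[OF that]] by simp
    also have "\<dots> \<le> infsum M UNIV"
      using M M0 by (intro finite_sum_le_infsum) auto
    finally show ?thesis .
  qed
  then show "\<exists>B. \<forall>N \<theta>. \<bar>\<theta>\<bar> \<le> pi \<longrightarrow>
      \<bar>\<Sum>l=-int N..int N. line_symbol p \<alpha> (\<theta> + 2 * real_of_int l * pi)\<bar> \<le> B" by blast
  assume \<theta>: "\<bar>\<theta>\<bar> \<le> pi"
  have "(\<lambda>l. norm (line_symbol p \<alpha> (\<theta> + 2 * real_of_int l * pi))) summable_on UNIV"
    using M le[OF \<theta>] by (rule summable_on_comparison_test) auto
  then have "(\<lambda>l. line_symbol p \<alpha> (\<theta> + 2 * real_of_int l * pi)) summable_on UNIV"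
    by (rule abs_summable_summable)
  from infsum_tendsto[OF this]
  have lim: "(sum (\<lambda>l. line_symbol p \<alpha> (\<theta> + 2 * real_of_int l * pi)) \<longlongrightarrow> symbol_f p \<alpha> \<theta>) (finite_subsets_at_top UNIV)"
    by (simp add: symbol_f_eq_line_symbol)
  have "filterlim (\<lambda>N. - int N) at_bot sequentially"
    unfolding filterlim_at_bot
  proof
    show "\<forall>\<^sub>F N in sequentially. - int N \<le> Z" for Z
      using eventually_ge_at_top[of "nat (- Z)"] by eventually_elim linarith
  qed
  then have "filterlim (\<lambda>N. {-int N..int N}) (finite_subsets_at_top UNIV) sequentially"
    by (intro filterlim_atLeastAtMost_at_bot_at_top filterlim_int_sequentially) auto
  from filterlim_compose[OF lim this]
  show "(\<lambda>N. \<Sum>l=-int N..int N. line_symbol p \<alpha> (\<theta> + 2 * real_of_int l * pi)) \<longlonglongrightarrow> symbol_f p \<alpha> \<theta>" .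
qed

text \<open>The translates of one period tile a symmetric interval, and the induction attaches a
  tile at either end.\<close>

lemma has_integral_periodization:
  fixes h :: "real \<Rightarrow> complex"
  assumes "\<And>a b. h integrable_on {a..b}"
  shows "((\<lambda>\<theta>. \<Sum>l=-int N..int N. h (\<theta> + 2 * real_of_int l * pi)) has_integral
      integral {- ((2 * real N + 1) * pi)..(2 * real N + 1) * pi} h) {-pi..pi}"
proof -
  have shift: "((\<lambda>\<theta>. h (\<theta> + 2 * real_of_int l * pi)) has_integral
      integral {- pi + 2 * real_of_int l * pi..pi + 2 * real_of_int l * pi} h) {-pi..pi}" for l
    using has_integral_shift_Icc_real[of h "2 * real_of_int l * pi" _ "- pi" pi] assms
    by (simp add: o_def add.commute has_integral_integral)
  show ?thesis
  proof (induction N)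
    case 0
    then show ?case using shift[of 0] by simp
  next
    case (Suc N)
    have ivl: "{-int (Suc N)..int (Suc N)} = insert (int (Suc N)) (insert (- int (Suc N)) {-int N..int N})"
      by auto
    have add: "integral {a..c} h = integral {a..b} h + integral {b..c} h" if "a \<le> b" "b \<le> c" for a b c
      using Henstock_Kurzweil_Integration.integral_combine[OF that assms] by simp
    let ?A = "\<lambda>x. (2 * x + 1) * pi"
    have "((\<lambda>\<theta>. h (\<theta> + 2 * real_of_int (int (Suc N)) * pi) + (h (\<theta> + 2 * real_of_int (- int (Suc N)) * pi)
        + (\<Sum>l=-int N..int N. h (\<theta> + 2 * real_of_int l * pi)))) has_integral
      integral {?A (real N)..?A (real (Suc N))} h + (integral {- ?A (real (Suc N)).. - ?A (real N)} h
        + integral {- ?A (real N)..?A (real N)} h)) {-pi..pi}"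
      using Suc.IH shift[of "int (Suc N)"] shift[of "- int (Suc N)"]
      by (intro has_integral_add) (simp_all add: algebra_simps)
    also have "integral {?A (real N)..?A (real (Suc N))} h + (integral {- ?A (real (Suc N)).. - ?A (real N)} h
        + integral {- ?A (real N)..?A (real N)} h) = integral {- ?A (real (Suc N))..?A (real (Suc N))} h"
    proof -
      have le: "- ?A (real (Suc N)) \<le> - ?A (real N)" "- ?A (real N) \<le> ?A (real N)" "?A (real N) \<le> ?A (real (Suc N))"
        by (auto intro!: mult_right_mono order_trans[of "- ?A (real N)" 0 "?A (real N)"])
      show ?thesis
        using add[OF le(1) order_trans[OF le(2,3)]] add[OF le(2,3)] by simp
    qed
    finally show ?case
      unfolding ivl by (subst sum.insert, simp, simp, subst sum.insert, simp, simp) simp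
  qed
qed

lemma integral_Icc_tendsto_integral_Ioi:
  fixes f :: "real \<Rightarrow> complex"
  assumes f: "f absolutely_integrable_on {0<..}" and a: "filterlim a at_top sequentially"
  shows "(\<lambda>n. integral {0..a n} f) \<longlonglongrightarrow> integral {0<..} f"
proof -
  have int: "f integrable_on {0<..}" "(\<lambda>x. norm (f x)) integrable_on {0<..}"
    using f by (auto simp: absolutely_integrable_on_def)
  have part: "((\<lambda>x. if x \<in> {0<..a n} then f x else 0) has_integral integral {0..a n} f) {0<..}" for n
  proof (subst has_integral_restrict)
    have "f absolutely_integrable_on {0<..a n}"
      by (rule set_integrable_subset[OF f]) auto
    then have "(f has_integral integral {0<..a n} f) {0<..a n}"
      by (auto simp: absolutely_integrable_on_def)
    moreover have "integral {0..a n} f = integral {0<..a n} f"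
      by (rule integral_subset_negligible[symmetric]) (auto intro: negligible_subset[of "{0}"])
    ultimately show "(f has_integral integral {0..a n} f) {0<..a n}" by simp
  qed auto
  note eq = integral_unique[OF part, symmetric]
  show ?thesis
    unfolding eq
  proof (rule dominated_convergence(2)[OF _ int(2)])
    show "(\<lambda>x. if x \<in> {0<..a n} then f x else 0) integrable_on {0<..}" for n
      using part by (rule has_integral_integrable)
    fix x :: real assume x: "x \<in> {0<..}"
    have "eventually (\<lambda>n. x \<le> a n) sequentially"
      using a by (simp add: filterlim_at_top)
    then show "(\<lambda>n. if x \<in> {0<..a n} then f x else 0) \<longlonglongrightarrow> f x"
      using x by (intro tendsto_eventually) (simp add: eventually_mono)
  qed auto
qed

text \<open>The exponential is \<open>2 * pi\<close>-periodic, so it factors out of the periodized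
  sum. Conjugate symmetry \<open>h (- \<xi>) = cnj (h \<xi>)\<close> makes the integral over a
  symmetric interval twice a real part, and that 2 cancels against the prefactor
  \<open>1 / (2 * pi)\<close>.\<close>

lemma fourier_coeff_symbol_f:
  fixes k :: int and p :: nat and \<alpha> :: real
  defines "h \<equiv> \<lambda>\<xi>. of_real (line_symbol p \<alpha> \<xi>) * exp (- \<i> * of_int k * of_real \<xi>)"
  assumes \<alpha>: "1 < \<alpha>" "\<alpha> < 2" "2 \<le> p" and abs: "h absolutely_integrable_on {0<..}"
  shows "fourier_coeff (symbol_f p \<alpha>) k = of_real (Re (integral {0<..} h) / pi)"
proof -
  define E where "E = (\<lambda>\<theta>::real. exp (- \<i> * of_int k * of_real \<theta>))"
  have h: "h \<xi> = of_real (line_symbol p \<alpha> \<xi>) * E \<xi>" for \<xi> by (simp add: h_def E_def)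
  have E_shift: "E (\<theta> + 2 * real_of_int l * pi) = E \<theta>" for \<theta> l
  proof -
    have "- \<i> * of_int k * of_real (\<theta> + 2 * real_of_int l * pi)
        = - \<i> * of_int k * of_real \<theta> + of_real (2 * real_of_int (- (k * l)) * pi) * \<i>"
      by (simp add: algebra_simps)
    then show ?thesis
      unfolding E_def by (simp only: exp_add exp_integer_2pi[OF Ints_of_int] mult_1_right)
  qed
  have normE: "norm (E \<theta>) = 1" for \<theta> by (simp add: E_def)
  have h_minus: "h (- \<xi>) = cnj (h \<xi>)" for \<xi>
    by (simp add: h line_symbol_minus E_def exp_cnj)
  have pos: "h integrable_on {0..a}" for a
  proof -
    have "h absolutely_integrable_on {0<..a}"
      by (rule set_integrable_subset[OF abs]) auto
    then have "h integrable_on {0<..a}" by (auto simp: absolutely_integrable_on_def)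
    then show ?thesis by (rule integrable_spike_set) (auto intro: negligible_subset[of "{0}"])
  qed
  have neg: "(h has_integral cnj (integral {0..a} h)) {-a..0}" for a
  proof -
    have "(cnj \<circ> h has_integral cnj (integral {0..a} h)) {0..a}"
      unfolding has_integral_cnj using pos[of a] by (rule integrable_integral)
    then have "((\<lambda>x. h (- x)) has_integral cnj (integral {0..a} h)) {0..a}"
      by (simp add: o_def h_minus)
    then show ?thesis
      using has_integral_reflect_real[where f = h and a = "- a" and b = 0] by simp
  qed
  have sym: "(h has_integral of_real (2 * Re (integral {0..a} h))) {-a..a}" if "a \<ge> 0" for a
  proof -
    have "(h has_integral cnj (integral {0..a} h) + integral {0..a} h) {-a..a}"
      using that by (intro has_integral_combine[OF _ _ neg integrable_integral[OF pos]]) auto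
    then show ?thesis using complex_add_cnj[of "integral {0..a} h"] by (simp add: add.commute)
  qed
  have int: "h integrable_on {a..b}" for a b
  proof -
    define c where "c = max \<bar>a\<bar> \<bar>b\<bar>"
    have "h integrable_on {-c..c}" by (rule has_integral_integrable[OF sym]) (simp add: c_def)
    then show ?thesis by (rule integrable_subinterval_real) (auto simp: c_def)
  qed
  define A where "A = (\<lambda>N. (2 * real N + 1) * pi)"
  have A: "A N \<ge> 0" for N by (simp add: A_def)
  have A_lim: "filterlim A at_top sequentially"
  proof (rule filterlim_at_top_mono[OF filterlim_real_sequentially always_eventually], rule allI)
    fix N
    have "real N * 1 \<le> (2 * real N + 1) * pi" using pi_ge_two by (intro mult_mono) auto
    then show "real N \<le> A N" by (simp add: A_def)
  qed
  define P where "P = (\<lambda>N \<theta>. \<Sum>l=-int N..int N. h (\<theta> + 2 * real_of_int l * pi))"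
  have P_eq: "P N \<theta> = of_real (\<Sum>l=-int N..int N. line_symbol p \<alpha> (\<theta> + 2 * real_of_int l * pi)) * E \<theta>" for N \<theta>
    by (simp add: P_def h E_shift sum_distrib_right)
  have P_int: "(P N has_integral of_real (2 * Re (integral {0..A N} h))) {-pi..pi}" for N
    using has_integral_periodization[OF int, of N] integral_unique[OF sym[OF A[of N]]]
    by (simp add: P_def A_def)
  obtain B where B: "\<And>N \<theta>. \<bar>\<theta>\<bar> \<le> pi \<Longrightarrow> \<bar>\<Sum>l=-int N..int N. line_symbol p \<alpha> (\<theta> + 2 * real_of_int l * pi)\<bar> \<le> B"
    using line_symbol_partial_sums(1)[OF \<alpha>] by blast
  have "((\<lambda>\<theta>. of_real (symbol_f p \<alpha> \<theta>) * E \<theta>) has_integral of_real (2 * Re (integral {0<..} h))) {-pi..pi}"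
  proof (rule has_integral_dominated_convergence[OF P_int])
    show "(\<lambda>_. B) integrable_on {-pi..pi}" by (rule integrable_const_ivl)
    show "\<forall>\<theta>\<in>{-pi..pi}. norm (P N \<theta>) \<le> B" for N
    proof
      fix \<theta> assume "\<theta> \<in> {-pi..pi}"
      then have "\<bar>\<theta>\<bar> \<le> pi" by auto
      from B[OF this, of N] show "norm (P N \<theta>) \<le> B"
        unfolding P_eq norm_mult normE norm_of_real by simp
    qed
    show "\<forall>\<theta>\<in>{-pi..pi}. (\<lambda>N. P N \<theta>) \<longlonglongrightarrow> of_real (symbol_f p \<alpha> \<theta>) * E \<theta>"
      unfolding P_eq by (intro ballI tendsto_mult tendsto_const tendsto_of_real line_symbol_partial_sums(2) \<alpha>) auto
    show "(\<lambda>N. of_real (2 * Re (integral {0..A N} h))) \<longlonglongrightarrow> complex_of_real (2 * Re (integral {0<..} h))"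
      by (intro tendsto_of_real tendsto_mult tendsto_const tendsto_Re integral_Icc_tendsto_integral_Ioi abs A_lim)
  qed
  then have "integral {-pi..pi} (\<lambda>\<theta>. of_real (symbol_f p \<alpha> \<theta>) * E \<theta>) = of_real (2 * Re (integral {0<..} h))"
    by (rule integral_unique)
  then show ?thesis
    unfolding fourier_coeff_def E_def by simp
qed

section \<open>Evaluation of the half-line integral and comparison of the two sides\<close>

lemma two_sin_power_eq_expsum:
  "of_real ((2 * sin (\<xi> / 2)) ^ n) * exp (- \<i> * of_int k * of_real \<xi>)
     = (- \<i>) ^ n * expsum {..n} (\<lambda>j. (-1) ^ j * of_nat (n choose j))
         (\<lambda>j. - (\<i> * of_real (real n / 2 - real_of_int k - real j))) \<xi>"
proof -
  let ?e = "exp (\<i> * of_real \<xi> / 2)" and ?f = "exp (- \<i> * of_real \<xi> / 2)"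
  \<comment> \<open>Euler's formula. In the binomial expansion the \<open>j\<close>-th product of
    half-angle exponentials has frequency \<open>n / 2 - j\<close>, which the Fourier exponential
    shifts by \<open>- k\<close>.\<close>
  have "complex_of_real (2 * sin (\<xi> / 2)) = - \<i> * (- ?f + ?e)"
    by (simp add: sin_of_real[symmetric] sin_exp_eq' field_simps del: sin_of_real)
  then have "of_real ((2 * sin (\<xi> / 2)) ^ n) = (- \<i> * (- ?f + ?e)) ^ n"
    by (simp only: of_real_power)
  then have sin_power: "of_real ((2 * sin (\<xi> / 2)) ^ n) = (- \<i>) ^ n * (\<Sum>j\<le>n. of_nat (n choose j) * (- ?f) ^ j * ?e ^ (n - j))"
    by (simp only: power_mult_distrib binomial_ring)
  have summand: "of_nat (n choose j) * (- ?f) ^ j * ?e ^ (n - j) * exp (- \<i> * of_int k * of_real \<xi>)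
      = (-1) ^ j * of_nat (n choose j) * exp (- (- (\<i> * of_real (real n / 2 - real_of_int k - real j)) * of_real \<xi>))"
    if "j \<le> n" for j
  proof -
    have "?f ^ j * ?e ^ (n - j) * exp (- \<i> * of_int k * of_real \<xi>)
      = exp (of_nat j * (- \<i> * of_real \<xi> / 2) + of_nat (n - j) * (\<i> * of_real \<xi> / 2) + - \<i> * of_int k * of_real \<xi>)"
      by (simp only: exp_add exp_of_nat_mult)
    also have "of_nat j * (- \<i> * of_real \<xi> / 2) + of_nat (n - j) * (\<i> * of_real \<xi> / 2) + - \<i> * of_int k * of_real \<xi>
       = - (- (\<i> * of_real (real n / 2 - real_of_int k - real j)) * of_real \<xi>)"
      using that by (simp add: of_nat_diff field_simps)
    finally show ?thesis
      by (simp only: power_minus[of ?f] mult_ac)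
  qed
  show ?thesis
    unfolding sin_power expsum_def mult.assoc[of "(- \<i>) ^ n"] sum_distrib_right
    by (intro arg_cong[where f = "(*) ((- \<i>) ^ n)"] sum.cong refl summand) simp
qed


text \<open>On the positive half-line the denominator \<open>(\<xi> / 2) ^ (p + 1)\<close> lowers
  the exponent from \<alpha> to \<open>- b - 1\<close> with \<open>b = p - \<alpha>\<close>, and the
  sine power is an exponential sum with \<open>p + 1\<close> vanishing moments. The formula on the
  imaginary axis then applies with \<open>m = p + 1\<close>.\<close>

lemma
  fixes k :: int and p :: nat and \<alpha> :: real
  defines "h \<equiv> \<lambda>\<xi>. of_real (line_symbol p \<alpha> \<xi>) * exp (- \<i> * of_int k * of_real \<xi>)"
  assumes \<alpha>: "1 < \<alpha>" "\<alpha> < 2" "2 \<le> p"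
  shows absolutely_integrable_line_symbol: "h absolutely_integrable_on {0<..}"
    and integral_line_symbol: "integral {0<..} h =
      (- \<i>) ^ (p + 1) * (of_real (Gamma (\<alpha> - real p)) * (\<Sum>j\<le>p + 1. (-1) ^ j * of_nat (p + 1 choose j) *
         (- (\<i> * of_real ((real p + 1) / 2 - real_of_int k - real j))) powr of_real (real p - \<alpha>)))"
proof -
  define b where "b = real p - \<alpha>"
  define a where "a = (\<lambda>j. (real p + 1) / 2 - real_of_int k - real j)"
  define c where "c = (\<lambda>j. (-1) ^ j * of_nat (p + 1 choose j) :: complex)"
  let ?g = "\<lambda>t. of_real (t powr (- b - 1)) * expsum {..p + 1} c (\<lambda>j. - (\<i> * of_real (a j))) t"
  have b: "b > 0" "b < real (p + 1)" using \<alpha> by (auto simp: b_def)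
  \<comment> \<open>No integer lies strictly between 1 and 2; this keeps \<open>Gamma (- b)\<close>
    away from the poles.\<close>
  have b_nonint: "b \<notin> \<int>"
  proof
    assume "b \<in> \<int>"
    then have "real p - b \<in> \<int>" by (intro Ints_diff) auto
    then obtain m where "\<alpha> = of_int m" by (auto simp: b_def elim: Ints_cases)
    then show False using \<alpha> by auto
  qed
  \<comment> \<open>The nodes \<open>e - \<i> * a j\<close> are affine in \<open>j\<close> with
    slope \<open>\<i>\<close>, so the finite difference identity covers every
    \<open>e\<close>.\<close>
  have moments: "(\<Sum>j\<le>p + 1. c j * (of_real e - \<i> * of_real (a j)) ^ m) = 0" if "m < p + 1" for m e
    using sum_binomial_power_eq_0[OF that, of "of_real e - \<i> * of_real ((real p + 1) / 2 - real_of_int k)" \<i>]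
    by (simp add: c_def a_def algebra_simps del: sum.atMost_Suc binomial_Suc_Suc)
  have h: "h t = (- \<i>) ^ (p + 1) * ?g t" if t: "t \<in> {0<..}" for t
  proof -
    have "line_symbol p \<alpha> t = t powr (- b - 1) * (2 * sin (t / 2)) ^ (p + 1)"
    proof -
      have "t powr real (p + 1) = t ^ (p + 1)" using t by (intro powr_realpow) simp
      moreover have "- b - 1 = \<alpha> - real (p + 1)" by (simp add: b_def)
      ultimately have "t powr (- b - 1) = t powr \<alpha> / t ^ (p + 1)" by (simp only: powr_diff)
      moreover have "sin (t / 2) / (t / 2) = 2 * sin (t / 2) / t" by simp
      ultimately show ?thesis
        using t unfolding line_symbol_def by (simp only: power_divide) simp
    qed
    then show ?thesis
      using two_sin_power_eq_expsum[of t "p + 1" k]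
      by (simp add: h_def a_def c_def mult_ac add.commute del: of_real_power binomial_Suc_Suc power_Suc)
  qed
  have "?g absolutely_integrable_on {0<..}"
    using moments[of _ 0] b by (intro absolutely_integrable_powr_expsum_imaginary[where m = "p + 1"]) auto
  then have "(\<lambda>t. (- \<i>) ^ (p + 1) * ?g t) absolutely_integrable_on {0<..}"
    by (rule set_integrable_mult_right)
  then show "h absolutely_integrable_on {0<..}"
    by (rule absolutely_integrable_spike[OF _ negligible_empty]) (use h in auto)
  have "(?g has_integral of_real (Gamma (- b)) * (\<Sum>j\<le>p + 1. c j * (- (\<i> * of_real (a j))) powr of_real b)) {0<..}"
    by (rule has_integral_powr_expsum_imaginary[where m = "p + 1"]) (use b b_nonint moments in auto)
  then have "((\<lambda>t. (- \<i>) ^ (p + 1) * ?g t) has_integral (- \<i>) ^ (p + 1) * (of_real (Gamma (- b)) *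
      (\<Sum>j\<le>p + 1. c j * (- (\<i> * of_real (a j))) powr of_real b))) {0<..}"
    by (rule has_integral_mult_right)
  then have "(h has_integral (- \<i>) ^ (p + 1) * (of_real (Gamma (- b)) *
      (\<Sum>j\<le>p + 1. c j * (- (\<i> * of_real (a j))) powr of_real b))) {0<..}"
    by (rule has_integral_eq[rotated]) (use h in auto)
  from integral_unique[OF this]
  show "integral {0<..} h =
      (- \<i>) ^ (p + 1) * (of_real (Gamma (\<alpha> - real p)) * (\<Sum>j\<le>p + 1. (-1) ^ j * of_nat (p + 1 choose j) *
         (- (\<i> * of_real ((real p + 1) / 2 - real_of_int k - real j))) powr of_real (real p - \<alpha>)))"
    unfolding a_def b_def c_def by simp
qed

text \<open>The angle is \<open>p * pi + pi / 2 - pi * \<alpha> / 2\<close> for \<open>a > 0\<close>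
  and \<open>pi / 2 + pi * \<alpha> / 2\<close> for \<open>a < 0\<close>. Both cosines are
  \<open>sin (pi * \<alpha> / 2)\<close> up to sign, so the left and right truncated powers share a
  common factor.\<close>

lemma cos_sgn_eq:
  "\<bar>a\<bar> powr b * cos (pi / 2 * (real p + 1 + (real p - \<alpha>) * sgn a)) =
     (-1) ^ p * sin (pi * \<alpha> / 2) * (max 0 a powr b + (-1) ^ (p + 1) * max 0 (- a) powr b)"
proof -
  consider "a > 0" | "a < 0" | "a = 0" by linarith
  then show ?thesis
  proof cases
    case 1
    have "pi / 2 * (real p + 1 + (real p - \<alpha>) * sgn a) = real p * pi + (pi / 2 - pi * \<alpha> / 2)"
      using 1 by (simp add: algebra_simps)
    then have "cos (pi / 2 * (real p + 1 + (real p - \<alpha>) * sgn a)) = (-1) ^ p * sin (pi * \<alpha> / 2)"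
      by (simp only: cos_add cos_npi sin_npi cos_diff) simp
    then show ?thesis using 1 by simp
  next
    case 2
    have "pi / 2 * (real p + 1 + (real p - \<alpha>) * sgn a) = pi / 2 + pi * \<alpha> / 2"
      using 2 by (simp add: algebra_simps)
    then have "cos (pi / 2 * (real p + 1 + (real p - \<alpha>) * sgn a)) = - sin (pi * \<alpha> / 2)"
      by (simp only: cos_add) simp
    then show ?thesis using 2 by simp
  qed simp
qed

lemma Gamma_reflection_real:
  fixes x :: real
  shows "Gamma x * Gamma (1 - x) = pi / sin (pi * x)"
proof -
  have "complex_of_real (Gamma x * Gamma (1 - x)) = Gamma (of_real x) * Gamma (1 - of_real x)"
    by (simp flip: Gamma_complex_of_real)
  also have "\<dots> = of_real (pi / sin (pi * x))"
    by (simp add: Gamma_reflection_complex sin_of_real flip: of_real_mult)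
  finally show ?thesis by (simp only: of_real_eq_iff)
qed

lemma tcoef_eq_fourier_coeff:
  assumes \<alpha>: "1 < \<alpha>" "\<alpha> < 2" "2 \<le> p"
  shows "complex_of_real (tcoef p \<alpha> k) = fourier_coeff (symbol_f p \<alpha>) k"
proof -
  define b where "b = real p - \<alpha>"
  define x where "x = (real p + 1) / 2 - real_of_int k"
  define h where "h = (\<lambda>\<xi>. complex_of_real (line_symbol p \<alpha> \<xi>) * exp (- \<i> * of_int k * of_real \<xi>))"
  define S where "S = frac_spline p b x + frac_spline p b (real p + 1 - x)"
  define c where "c = (\<lambda>j. (-1) ^ j * real (p + 1 choose j))"
  have b: "b > 0" using \<alpha> by (simp add: b_def)
  have i: "(- \<i>) ^ (p + 1) = cis (- (pi / 2 * (real p + 1)))"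
  proof -
    have "- \<i> = cis (- (pi / 2))" by (simp add: complex_eq_iff)
    then have "(- \<i>) ^ (p + 1) = cis (real (p + 1) * - (pi / 2))" by (simp only: Complex.DeMoivre)
    then show ?thesis by (simp add: algebra_simps del: power_Suc)
  qed
  have "integral {0<..} h = (\<Sum>j\<le>p + 1. of_real (Gamma (- b) * (c j * \<bar>x - real j\<bar> powr b)) *
      cis (- (pi / 2 * (real p + 1 + b * sgn (x - real j)))))"
  proof -
    have split: "cis (- (pi / 2 * (real p + 1 + b * s))) = cis (- (pi / 2 * (real p + 1))) * cis (- (pi / 2 * b * s))" for s
      unfolding cis_mult by (rule arg_cong[where f = cis]) (simp add: field_simps)
    show ?thesis
      unfolding h_def integral_line_symbol[OF \<alpha>] i minus_i_powr[OF b[unfolded b_def]] sum_distrib_left split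
      by (intro sum.cong refl) (simp add: b_def c_def x_def del: binomial_Suc_Suc)
  qed
  then have "Re (integral {0<..} h) = (\<Sum>j\<le>p + 1. Gamma (- b) * (c j * (\<bar>x - real j\<bar> powr b *
      cos (pi / 2 * (real p + 1 + b * sgn (x - real j))))))"
    by (simp only: Re_sum) (simp add: mult.assoc del: sum.atMost_Suc)
  also have "\<dots> = Gamma (- b) * (-1) ^ p * sin (pi * \<alpha> / 2) *
      (\<Sum>j\<le>p + 1. c j * (max 0 (x - real j) powr b + (-1) ^ (p + 1) * max 0 (real j - x) powr b))"
    unfolding b_def cos_sgn_eq sum_distrib_left by (intro sum.cong refl) (simp add: mult_ac)
  \<comment> \<open>Up to \<open>Gamma (b + 1)\<close>, the powers of
    \<open>max 0 (x - real j)\<close> form the left derivative and, by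
    \<open>frac_spline_reflect\<close>, the others form the right one.\<close>
  also have "(\<Sum>j\<le>p + 1. c j * (max 0 (x - real j) powr b + (-1) ^ (p + 1) * max 0 (real j - x) powr b)) = Gamma (b + 1) * S"
  proof -
    have "Gamma (b + 1) > 0" using b by (intro Gamma_real_pos) simp
    then have "Gamma (b + 1) * S =
      (\<Sum>j\<le>Suc p. (-1) ^ j * real (Suc p choose j) * max 0 (x - real j) powr b) +
      (\<Sum>j\<le>Suc p. (-1) ^ Suc p * ((-1) ^ j * real (Suc p choose j)) * max 0 (real j - x) powr b)"
      unfolding S_def frac_spline_reflect unfolding frac_spline_def
      by (simp add: distrib_left del: sum.atMost_Suc binomial_Suc_Suc power_Suc)
    then show ?thesis
      by (simp add: c_def algebra_simps sum.distrib del: sum.atMost_Suc binomial_Suc_Suc power_Suc)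
  qed
  \<comment> \<open>Since \<open>b + 1 = 1 - (- b)\<close>, the reflection formula at
    \<open>- b\<close> disposes of both Gamma factors.\<close>
  also have "Gamma (- b) * (-1) ^ p * sin (pi * \<alpha> / 2) * (Gamma (b + 1) * S) =
      (Gamma (- b) * Gamma (1 - (- b))) * ((-1) ^ p * sin (pi * \<alpha> / 2) * S)"
    by (simp add: add.commute)
  also have "Gamma (- b) * Gamma (1 - (- b)) = pi / sin (pi * - b)"
    by (rule Gamma_reflection_real)
  also have "sin (pi * - b) = (-1) ^ p * sin (pi * \<alpha>)"
  proof -
    have "pi * - b = pi * \<alpha> - real p * pi" by (simp add: b_def algebra_simps)
    then show ?thesis by (simp only: sin_diff cos_npi sin_npi) simp
  qed
  \<comment> \<open>Angle doubling produces the factor \<open>2 * cos (pi * \<alpha> / 2)\<close> of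
    \<open>tcoef\<close>; the sine, positive because \<open>0 < pi * \<alpha> / 2 < pi\<close>,
    cancels.\<close>
  also have "sin (pi * \<alpha>) = 2 * sin (pi * \<alpha> / 2) * cos (pi * \<alpha> / 2)"
    using sin_double[of "pi * \<alpha> / 2"] by simp
  also have "pi / ((-1) ^ p * (2 * sin (pi * \<alpha> / 2) * cos (pi * \<alpha> / 2))) * ((-1) ^ p * sin (pi * \<alpha> / 2) * S)
      = pi * (1 / (2 * cos (pi * \<alpha> / 2)) * S)"
  proof -
    have "sin (pi * \<alpha> / 2) > 0" using \<alpha> by (intro sin_gt_zero) auto
    then show ?thesis by simp
  qed
  also have "1 / (2 * cos (pi * \<alpha> / 2)) * S = tcoef p \<alpha> k"
    unfolding tcoef_def RL_bspline[OF \<alpha>] S_def x_def b_def by simp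
  finally have "Re (integral {0<..} h) / pi = tcoef p \<alpha> k" by simp
  moreover have "fourier_coeff (symbol_f p \<alpha>) k = of_real (Re (integral {0<..} h) / pi)"
    unfolding h_def by (intro fourier_coeff_symbol_f absolutely_integrable_line_symbol \<alpha>)
  ultimately show ?thesis by simp
qed

theorem theorem5p1:
  fixes \<alpha> :: real and p n :: nat
  assumes "1 < \<alpha>" and "\<alpha> < 2" and "2 \<le> p" and "1 \<le> n"
  shows "Tmat n p \<alpha> = toeplitz (n + p - 2) (symbol_f p \<alpha>)
         \<and> (\<forall>k::int. complex_of_real (tcoef p \<alpha> k) = fourier_coeff (symbol_f p \<alpha>) k)"
  using tcoef_eq_fourier_coeff[OF assms(1-3)]
  by (auto simp: Tmat_def toeplitz_def fun_eq_iff)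

end
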